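(* Let $N\ge1$, $0<p<q<\infty$ and $\gamma\in(0,\infty]$. There exist constants $C_1,C_2,C_3>0$ depending only on $\gamma,p,q,N$ such that for every $u\in BMO(\mathbb{R}^N)$ which is not almost everywhere equal to a nonzero constant, $$\|u\|_{L^{q,\gamma}(\mathbb{R}^N)}\le C_1\Big\|\min\big\{|u|,\|u\|_{BMO(\mathbb{R}^N)}\big\}\Big\|_{L^{q,\gamma}(\mathbb{R}^N)}$$ $$\le C_2\sup_{0<s\le \|u\|_{BMO(\mathbb{R}^N)}^p}\Big[s\,\mathcal{L}^N\big(\{x\in \mathbb{R}^N:|u(x)|^p>s\}\big)\Big]^{\frac1q}\,\|u\|_{BMO(\mathbb{R}^N)}^{1-\frac pq}\le C_3\,[u]_{L^p_w(\mathbb{R}^N)}^{\frac pq}\,\|u\|_{BMO(\mathbb{R}^N)}^{1-\frac pq},$$ all inequalities being in $[0,\infty]$.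
   Context: $\mathcal{L}^N$ is Lebesgue measure. A cube is a Cartesian product of $N$ non-empty closed bounded intervals of the same (positive) length. For real-valued $u\in L^1_{\mathrm{loc}}(\mathbb{R}^N)$, $u\in BMO(\mathbb{R}^N)$ means that $$\|u\|_{BMO(\mathbb{R}^N)}:=\sup\left\{\frac{1}{\mathcal{L}^N(C)^2}\int_C\int_C|u(z)-u(x)|\,dz\,dx : C\subset \mathbb{R}^N\text{ a cube}\right\}<\infty .$$ Lorentz quasi-norms (with Lebesgue measure on $X$, possibly $+\infty$): for $0<q<\infty$, $$\|f\|_{L^{q,\gamma}(X)}:=\left[\int_0^\infty\big(\mathcal{L}^N(\{x\in X:|f(x)|^q>t\})\big)^{\frac{\gamma}{q}}t^{\frac{\gamma}{q}-1}dt\right]^{1/\gamma}\ (0<\gamma<\infty),$$ $$\|f\|_{L^{q,\infty}(X)}:=\left[\sup_{0<t<\infty}t\,\mathcal{L}^N(\{x\in X:|f(x)|^q>t\})\right]^{1/q},$$ and $[f]_{L^p_w(X)}:=\|f\|_{L^{p,\infty}(X)}$. Conventions: $0\cdot\infty=0\cdot(-\infty)=0$; in particular, if $\|u\|_{BMO(\mathbb{R}^N)}=0$ the expression containing the supremum over the empty set is $0$. *)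

theory Defs
  imports "HOL-Analysis.Analysis"
begin

(* Powers on [0,\<infinity>].  Only positive exponents a are ever used; there 0 powr a = 0, as wanted. *)
definition ennpowr :: "ennreal \<Rightarrow> real \<Rightarrow> ennreal" where
  "ennpowr x a = (if x = \<infinity> then \<infinity> else ennreal (enn2real x powr a))"

definition is_cube :: "(real ^ 'n) set \<Rightarrow> bool" where
  "is_cube C \<longleftrightarrow> (\<exists>a b l. 0 < l \<and> (\<forall>i. b $ i - a $ i = l) \<and> C = cbox a b)"

definition locally_integrable :: "(real ^ 'n \<Rightarrow> real) \<Rightarrow> bool" where
  "locally_integrable u \<longleftrightarrow> (\<forall>K. compact K \<longrightarrow> u absolutely_integrable_on K)"

definition bmo_norm :: "(real ^ 'n \<Rightarrow> real) \<Rightarrow> ennreal" where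
  "bmo_norm u = (SUP C\<in>Collect is_cube.
     1 / (emeasure lebesgue C)\<^sup>2 *
     (\<integral>\<^sup>+x\<in>C. (\<integral>\<^sup>+z\<in>C. ennreal \<bar>u z - u x\<bar> \<partial>lebesgue) \<partial>lebesgue))"

definition BMO :: "(real ^ 'n \<Rightarrow> real) set" where
  "BMO = {u. locally_integrable u \<and> bmo_norm u < \<infinity>}"

definition lorentz_norm :: "real \<Rightarrow> ennreal \<Rightarrow> (real ^ 'n) set \<Rightarrow> (real ^ 'n \<Rightarrow> real) \<Rightarrow> ennreal" where
  "lorentz_norm q \<gamma> X f =
    (if \<gamma> = \<infinity> then
       ennpowr (SUP t\<in>{0<..}. ennreal t * emeasure lebesgue {x\<in>X. \<bar>f x\<bar> powr q > t}) (1 / q)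
     else
       ennpowr (\<integral>\<^sup>+t\<in>{0<..}.
           (ennpowr (emeasure lebesgue {x\<in>X. \<bar>f x\<bar> powr q > t}) (enn2real \<gamma> / q) *
            ennreal (t powr (enn2real \<gamma> / q - 1))) \<partial>lborel) (1 / enn2real \<gamma>))"

definition weak_Lp_norm :: "real \<Rightarrow> (real ^ 'n) set \<Rightarrow> (real ^ 'n \<Rightarrow> real) \<Rightarrow> ennreal" where
  "weak_Lp_norm p X f = lorentz_norm p \<infinity> X f"

end

theory Submission
  imports Defs
begin

text \<open>
  Write \<open>B\<close> for the BMO norm of \<open>u\<close> and \<open>m t\<close> for the measure of \<open>{\<bar>u\<bar> > t}\<close>.  The first inequality
  rests on a global form of the John--Nirenberg inequality: if \<open>m t\<close> is finite, then
  \<open>m (t + K B) \<le> m t / 2\<close> with \<open>K = 2\<^sup>N\<^sup>+\<^sup>3\<close>.  Indeed, almost all of \<open>E = {\<bar>u\<bar> > t}\<close> is covered by the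
  maximal dyadic cubes \<open>Q\<close> that \<open>E\<close> fills by more than one half.  At least half of the parent of such
  a \<open>Q\<close> lies outside \<open>E\<close>, so a large part of \<open>{\<bar>u\<bar> > t + K B}\<close> in \<open>Q\<close> would make the oscillation of \<open>u\<close>
  on the parent exceed \<open>B\<close>.  Iteration gives \<open>m t \<le> D (B / t)\<^sup>2\<^sup>q m (B / 2)\<close> for \<open>t \<ge> B / 2\<close>, and the
  part of the Lorentz norm above height \<open>B\<close> is dominated by the part below.  The second inequality
  follows by inserting the weak bound on \<open>m\<close> below height \<open>B\<close>.
\<close>

section \<open>Comparing measures cube by cube\<close>

text \<open>Countable additivity over \<open>F\<close>, written as an integral against counting
  measure so that \<open>F\<close> needs no enumeration. Only \<open>A\<close> has to be covered:
  what \<open>E\<close> has outside the cubes merely enlarges the right side. It serves both the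
  density theorem and the halving of level sets.\<close>

lemma emeasure_le_disjoint_cover:
  assumes "countable F" "F \<subseteq> sets M" "disjoint F"
    and A: "A \<in> sets M" and E: "E \<in> sets M" and cover: "A \<subseteq> \<Union>F"
    and le: "\<And>Q. Q \<in> F \<Longrightarrow> emeasure M (A \<inter> Q) \<le> c * emeasure M (E \<inter> Q)"
  shows "emeasure M A \<le> c * emeasure M E"
proof -
  have split: "emeasure M (\<Union>Q\<in>F. S \<inter> Q) = (\<integral>\<^sup>+Q. emeasure M (S \<inter> Q) \<partial>count_space F)"
    if "S \<in> sets M" for S
    using assms that
    by (intro emeasure_UN_countable) (auto simp: disjoint_family_on_def disjoint_def)
  have "A = (\<Union>Q\<in>F. A \<inter> Q)"
    using cover by auto
  then have "emeasure M A = (\<integral>\<^sup>+Q. emeasure M (A \<inter> Q) \<partial>count_space F)"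
    using split[OF A] by simp
  also have "\<dots> \<le> (\<integral>\<^sup>+Q. c * emeasure M (E \<inter> Q) \<partial>count_space F)"
    by (rule nn_integral_mono) (simp add: le)
  also have "\<dots> = c * emeasure M (\<Union>Q\<in>F. E \<inter> Q)"
    by (simp only: split[OF E]) (simp add: nn_integral_cmult)
  also have "\<dots> \<le> c * emeasure M E"
    by (intro mult_left_mono emeasure_mono E) auto
  finally show ?thesis .
qed

subsection \<open>Dyadic cubes\<close>

text \<open>The half-open grid cube of side \<open>L / 2 ^ j\<close> containing \<open>x\<close>.
  Naming it by a point rather than by its index makes \<open>dyadic_cube L i x\<close> the ancestor
  of generation \<open>i\<close>. Generations start at 0, so there is a coarsest grid, whose mesh
  \<open>L\<close> can be chosen to suit.\<close>

definition dyadic_cube :: "real \<Rightarrow> nat \<Rightarrow> real ^ 'n \<Rightarrow> (real ^ 'n) set" where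
  "dyadic_cube L j x = {y. \<forall>i. \<lfloor>y $ i * 2 ^ j / L\<rfloor> = \<lfloor>x $ i * 2 ^ j / L\<rfloor>}"

lemma dyadic_cube_self: "x \<in> dyadic_cube L j x"
  by (simp add: dyadic_cube_def)

lemma dyadic_cube_eq: "y \<in> dyadic_cube L j x \<Longrightarrow> dyadic_cube L j y = dyadic_cube L j x"
  by (auto simp: dyadic_cube_def)

text \<open>The coarse index of a coordinate is the fine index divided, as an integer, by a power of
  two; hence equal fine indices force equal coarse ones.\<close>

lemma dyadic_cube_antimono:
  assumes "i \<le> j"
  shows "dyadic_cube L j x \<subseteq> dyadic_cube L i x"
proof -
  have "\<lfloor>r * 2 ^ i / L\<rfloor> = \<lfloor>r * 2 ^ j / L\<rfloor> div 2 ^ (j - i)" for r :: real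
  proof -
    have "r * 2 ^ i / L = (r * 2 ^ j / L) / real_of_int (2 ^ (j - i))"
      using assms power_add[of "2 :: real" i "j - i"] by simp
    then show ?thesis
      by (simp only: floor_divide_real_eq_div zero_le_power zero_le_numeral)
  qed
  then show ?thesis
    by (auto simp: dyadic_cube_def)
qed

text \<open>The inner and outer boxes have equal volume, which gives the volume of the half-open
  cube. The closed one also satisfies \<open>is_cube\<close>, so it can be tested in the BMO
  norm.\<close>

lemma dyadic_cube_sandwich:
  fixes x :: "real ^ 'n"
  assumes "0 < L"
  obtains a b where "\<forall>i. b $ i - a $ i = L / 2 ^ j"
    "box a b \<subseteq> dyadic_cube L j x" "dyadic_cube L j x \<subseteq> cbox a b"
proof -
  define a :: "real ^ 'n" where "a = (\<chi> i. real_of_int \<lfloor>x $ i * 2 ^ j / L\<rfloor> * L / 2 ^ j)"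
  define b :: "real ^ 'n" where "b = (\<chi> i. real_of_int (\<lfloor>x $ i * 2 ^ j / L\<rfloor> + 1) * L / 2 ^ j)"
  have iff: "\<lfloor>y * 2 ^ j / L\<rfloor> = k \<longleftrightarrow>
      real_of_int k * L / 2 ^ j \<le> y \<and> y < real_of_int (k + 1) * L / 2 ^ j" for y k
    using assms by (simp add: floor_eq_iff field_simps)
  show ?thesis
  proof (rule that[of b a])
    show "\<forall>i. b $ i - a $ i = L / 2 ^ j"
      by (simp add: a_def b_def field_simps)
    show "box a b \<subseteq> dyadic_cube L j x"
      by (auto simp: dyadic_cube_def mem_box_cart iff a_def b_def intro: less_imp_le)
    show "dyadic_cube L j x \<subseteq> cbox a b"
      unfolding dyadic_cube_def mem_box_cart iff subset_iff a_def b_def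
      by (simp add: less_imp_le)
  qed
qed

lemma dyadic_cube_sets [measurable]: "dyadic_cube L j x \<in> sets lebesgue"
proof -
  have "dyadic_cube L j x \<in> sets borel"
    unfolding dyadic_cube_def by measurable
  then show ?thesis
    by simp
qed

lemma emeasure_cart_cube:
  fixes a b :: "real ^ 'n"
  assumes "0 \<le> l" "\<forall>i. b $ i - a $ i = l"
  shows "emeasure lebesgue (box a b) = ennreal (l ^ CARD('n))"
    and "emeasure lebesgue (cbox a b) = ennreal (l ^ CARD('n))"
proof -
  have le: "a \<bullet> v \<le> b \<bullet> v" if "v \<in> Basis" for v
    using that assms diff_ge_0_iff_ge by (fastforce simp: Basis_vec_def inner_axis)
  have "(\<Prod>v\<in>Basis. (b - a) \<bullet> v) = (\<Prod>v\<in>(Basis :: (real ^ 'n) set). l)"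
    using assms by (intro prod.cong) (auto simp: Basis_vec_def inner_axis inner_diff_left)
  then have "(\<Prod>v\<in>Basis. (b - a) \<bullet> v) = l ^ CARD('n)"
    by simp
  then show "emeasure lebesgue (box a b) = ennreal (l ^ CARD('n))"
    "emeasure lebesgue (cbox a b) = ennreal (l ^ CARD('n))"
    using le by (simp_all add: emeasure_lborel_box_eq emeasure_lborel_cbox_eq)
qed

lemma emeasure_dyadic_cube:
  fixes x :: "real ^ 'n"
  assumes "0 < L"
  shows "emeasure lebesgue (dyadic_cube L j x) = ennreal ((L / 2 ^ j) ^ CARD('n))"
proof -
  obtain a b where ab: "\<forall>i. b $ i - a $ i = L / 2 ^ j"
    "box a b \<subseteq> dyadic_cube L j x" "dyadic_cube L j x \<subseteq> cbox a b"
    using dyadic_cube_sandwich[OF assms] by metis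
  have "0 \<le> L / 2 ^ j"
    using assms by simp
  note m = emeasure_cart_cube[OF this ab(1)]
  show ?thesis
    using emeasure_mono[OF ab(2), of lebesgue] emeasure_mono[OF ab(3), of lebesgue] m
    by (intro antisym) simp_all
qed

text \<open>A cube is determined by its generation and its vector of integer indices, although
  uncountably many points \<open>x\<close> name it.\<close>

lemma countable_dyadic_cubes: "countable {dyadic_cube L j x |j (x :: real ^ 'n). True}"
proof -
  have "{dyadic_cube L j x |j (x :: real ^ 'n). True}
      \<subseteq> (\<lambda>(j, k :: int ^ 'n). {y. \<forall>i. \<lfloor>y $ i * 2 ^ j / L\<rfloor> = k $ i}) ` UNIV"
  proof clarify
    fix j and x :: "real ^ 'n"
    have "dyadic_cube L j x = (\<lambda>(j, k :: int ^ 'n). {y. \<forall>i. \<lfloor>y $ i * 2 ^ j / L\<rfloor> = k $ i})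
        (j, \<chi> i. \<lfloor>x $ i * 2 ^ j / L\<rfloor>)"
      by (simp add: dyadic_cube_def)
    then show "dyadic_cube L j x \<in> range (\<lambda>(j, k :: int ^ 'n). {y. \<forall>i. \<lfloor>y $ i * 2 ^ j / L\<rfloor> = k $ i})"
      by blast
  qed
  moreover have "countable (UNIV :: (nat \<times> (int ^ 'n)) set)"
  proof -
    have "countable (range (\<lambda>v :: int ^ 'n. vec_nth v))"
      by (rule countable_subset[OF _ countable_PiE[of UNIV "\<lambda>_. UNIV"]]) auto
    then have "countable (UNIV :: (int ^ 'n) set)"
      by (rule countable_image_inj_on) (auto simp: inj_on_def vec_nth_inject)
    then show ?thesis
      by (simp flip: UNIV_Times_UNIV)
  qed
  ultimately show ?thesis
    by (meson countable_image countable_subset)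
qed

text \<open>A stopping-time selection: every point lying in some cube with \<open>P\<close> has a
  first generation at which \<open>P\<close> holds, because generations are bounded below by 0. The
  last clause says that all proper ancestors of a selected cube fail \<open>P\<close>, in particular
  its parent.\<close>

lemma maximal_dyadic_cubes:
  fixes P :: "(real ^ 'n) set \<Rightarrow> bool"
  shows "\<exists>F. countable F \<and> F \<subseteq> sets lebesgue \<and> disjoint F \<and>
    \<Union>F = {x. \<exists>j. P (dyadic_cube L j x)} \<and>
    (\<forall>Q\<in>F. \<exists>j x. Q = dyadic_cube L j x \<and> P Q \<and> (\<forall>i<j. \<not> P (dyadic_cube L i x)))"
proof -
  define F where "F = {dyadic_cube L j x |j x.
      P (dyadic_cube L j x) \<and> (\<forall>i<j. \<not> P (dyadic_cube L i x))}"
  have "countable F"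
    by (rule countable_subset[OF _ countable_dyadic_cubes[of L]]) (auto simp: F_def)
  moreover have "F \<subseteq> sets lebesgue"
    by (auto simp: F_def)
  moreover have "disjoint F"
    unfolding disjoint_def
  proof (intro ballI impI)
    fix Q R assume "Q \<in> F" "R \<in> F" "Q \<noteq> R"
    then obtain j x k y where
      Q: "Q = dyadic_cube L j x" "P Q" "\<forall>i<j. \<not> P (dyadic_cube L i x)" and
      R: "R = dyadic_cube L k y" "P R" "\<forall>i<k. \<not> P (dyadic_cube L i y)"
      by (auto simp: F_def)
    show "Q \<inter> R = {}"
    proof (rule ccontr)
      assume "Q \<inter> R \<noteq> {}"
      then obtain z where z: "z \<in> Q" "z \<in> R"
        by blast
      \<comment> \<open>Along the common point \<open>z\<close> both cubes have the same ancestors,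
        so \<open>j\<close> and \<open>k\<close> are each the first generation at which
        \<open>P\<close> holds at \<open>z\<close>.\<close>
      have Qz: "dyadic_cube L i x = dyadic_cube L i z" if "i \<le> j" for i
        using dyadic_cube_antimono[OF that, of L x] z(1) dyadic_cube_eq[of z L i x]
        unfolding Q(1) by blast
      have Rz: "dyadic_cube L i y = dyadic_cube L i z" if "i \<le> k" for i
        using dyadic_cube_antimono[OF that, of L y] z(2) dyadic_cube_eq[of z L i y]
        unfolding R(1) by blast
      have "j = k"
      proof (rule linorder_cases[of j k])
        assume "j < k"
        then show ?thesis
          using Q(1,2) R(3) Qz[of j] Rz[of j] by auto
      next
        assume "k < j"
        then show ?thesis
          using R(1,2) Q(3) Qz[of k] Rz[of k] by auto
      qed
      then show False
        using Q(1) R(1) Qz Rz \<open>Q \<noteq> R\<close> by simp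
    qed
  qed
  moreover have "\<Union>F = {x. \<exists>j. P (dyadic_cube L j x)}"
  proof (intro equalityI subsetI)
    fix z assume "z \<in> \<Union>F"
    then obtain j x where "z \<in> dyadic_cube L j x" "P (dyadic_cube L j x)"
      by (auto simp: F_def)
    then show "z \<in> {x. \<exists>j. P (dyadic_cube L j x)}"
      using dyadic_cube_eq[of z L j x] by (intro CollectI exI[of _ j]) simp
  next
    fix z assume "z \<in> {x. \<exists>j. P (dyadic_cube L j x)}"
    then have ex: "\<exists>j. P (dyadic_cube L j z)"
      by blast
    define j where "j = (LEAST j. P (dyadic_cube L j z))"
    have "P (dyadic_cube L j z)" "\<forall>i<j. \<not> P (dyadic_cube L i z)"
      unfolding j_def using LeastI_ex[OF ex] not_less_Least by blast+
    then have "dyadic_cube L j z \<in> F"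
      unfolding F_def by blast
    then show "z \<in> \<Union>F"
      using dyadic_cube_self by blast
  qed
  moreover have "\<exists>j x. Q = dyadic_cube L j x \<and> P Q \<and> (\<forall>i<j. \<not> P (dyadic_cube L i x))"
    if "Q \<in> F" for Q
    using that by (auto simp: F_def)
  ultimately show ?thesis
    by (intro exI[of _ F] conjI ballI)
qed

lemma dyadic_cube_shrinks:
  fixes x :: "real ^ 'n"
  assumes "0 < L" "open U" "x \<in> U"
  shows "\<exists>j. dyadic_cube L j x \<subseteq> U"
proof -
  obtain e where e: "0 < e" "ball x e \<subseteq> U"
    using assms open_contains_ball by blast
  \<comment> \<open>A crude bound for the diameter: the norm is at most the sum of the coordinates,
    each at most the side length.\<close>
  have "(\<lambda>j. real CARD('n) * L * (1 / 2) ^ j) \<longlonglongrightarrow> real CARD('n) * L * 0"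
    by (intro tendsto_mult tendsto_const LIMSEQ_power_zero) simp
  then have "eventually (\<lambda>j. real CARD('n) * L * (1 / 2) ^ j < e) sequentially"
    using e(1) by (intro order_tendstoD(2)) simp_all
  then obtain j where j: "real CARD('n) * L * (1 / 2) ^ j < e"
    by (auto simp: eventually_sequentially)
  have "dyadic_cube L j x \<subseteq> ball x e"
  proof
    fix y assume y: "y \<in> dyadic_cube L j x"
    obtain a b where ab: "\<forall>i. b $ i - a $ i = L / 2 ^ j" "dyadic_cube L j x \<subseteq> cbox a b"
      using dyadic_cube_sandwich[OF assms(1)] by metis
    have mem: "x \<in> cbox a b" "y \<in> cbox a b"
      using ab(2) y dyadic_cube_self by blast+
    have "\<bar>(x - y) $ i\<bar> \<le> L / 2 ^ j" for i
    proof -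
      have "a $ i \<le> x $ i" "x $ i \<le> b $ i" "a $ i \<le> y $ i" "y $ i \<le> b $ i"
        using mem by (auto simp: mem_box_cart)
      then show ?thesis
        using spec[OF ab(1), of i] by simp
    qed
    then have "(\<Sum>i\<in>UNIV. \<bar>(x - y) $ i\<bar>) \<le> (\<Sum>i\<in>(UNIV :: 'n set). L / 2 ^ j)"
      by (intro sum_mono) simp
    then have "norm (x - y) \<le> real CARD('n) * L * (1 / 2) ^ j"
      using norm_le_l1_cart[of "x - y"] by (simp add: power_divide)
    then show "y \<in> ball x e"
      using j by (simp add: dist_norm)
  qed
  then show ?thesis
    using e by blast
qed

text \<open>
  A dyadic form of the Lebesgue density theorem, obtained from outer regularity alone: an open set
  around the exceptional set is tiled by cubes that the exceptional set fills by at most one half.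
\<close>

lemma null_sets_dyadic_sparse:
  fixes E :: "(real ^ 'n) set"
  assumes L: "0 < L" and E: "E \<in> lmeasurable"
  shows "{x \<in> E. \<forall>j. emeasure lebesgue (E \<inter> dyadic_cube L j x)
      \<le> ennreal (1 / 2) * emeasure lebesgue (dyadic_cube L j x)} \<in> null_sets lebesgue"
proof -
  define A where "A = {x \<in> E. \<forall>j. emeasure lebesgue (E \<inter> dyadic_cube L j x)
      \<le> ennreal (1 / 2) * emeasure lebesgue (dyadic_cube L j x)}"
  let ?P = "\<lambda>Q. \<not> emeasure lebesgue (E \<inter> Q) \<le> ennreal (1 / 2) * emeasure lebesgue Q"
  \<comment> \<open>Here the selection only supplies measurability: \<open>A\<close> is
    \<open>E\<close> minus a countable union of cubes.\<close>
  obtain F where F: "countable F" "F \<subseteq> sets lebesgue"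
    "\<Union>F = {x. \<exists>j. ?P (dyadic_cube L j x)}"
    using maximal_dyadic_cubes[of ?P L] by (elim exE conjE) (rule that)
  have Eset: "E \<in> sets lebesgue"
    using E by auto
  have "A = E - \<Union>F"
    unfolding A_def F(3) by auto
  then have A: "A \<in> sets lebesgue"
    using sets.Diff[OF Eset sets.countable_Union[OF F(1,2)]] by simp
  have finA: "emeasure lebesgue A < \<infinity>"
  proof (rule le_less_trans)
    show "emeasure lebesgue A \<le> emeasure lebesgue E"
      using Eset by (intro emeasure_mono) (auto simp: A_def)
    show "emeasure lebesgue E < \<infinity>"
      using E unfolding fmeasurable_def by blast
  qed
  have small: "emeasure lebesgue A \<le> ennreal \<epsilon>" if eps: "0 < \<epsilon>" for \<epsilon>
  proof -
    obtain U where U: "open U" "A \<subseteq> U" "emeasure lebesgue (U - A) < ennreal \<epsilon>"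
      using sets_lebesgue_outer_open[OF A eps] by metis
    have Uset: "U \<in> sets lebesgue"
      using U(1) by simp
    \<comment> \<open>Requiring each cube to meet \<open>A\<close> lets it be renamed by a point of
      \<open>A\<close>, where the definition of \<open>A\<close> bounds its filling by one
      half.\<close>
    obtain G where G: "countable G" "G \<subseteq> sets lebesgue" "disjoint G"
      "\<Union>G = {x. \<exists>j. dyadic_cube L j x \<subseteq> U \<and> dyadic_cube L j x \<inter> A \<noteq> {}}"
      "\<forall>Q\<in>G. \<exists>j x. Q = dyadic_cube L j x \<and> (Q \<subseteq> U \<and> Q \<inter> A \<noteq> {}) \<and>
        (\<forall>i<j. \<not> (dyadic_cube L i x \<subseteq> U \<and> dyadic_cube L i x \<inter> A \<noteq> {}))"
      using maximal_dyadic_cubes[of "\<lambda>Q. Q \<subseteq> U \<and> Q \<inter> A \<noteq> {}" L]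
      by (elim exE conjE) (rule that)
    have "emeasure lebesgue A \<le> ennreal (1 / 2) * emeasure lebesgue U"
    proof (rule emeasure_le_disjoint_cover[OF G(1-3) A Uset])
      show "A \<subseteq> \<Union>G"
      proof
        fix x assume x: "x \<in> A"
        obtain j where "dyadic_cube L j x \<subseteq> U"
          using dyadic_cube_shrinks[OF L U(1)] x U(2) by blast
        then have "\<exists>j. dyadic_cube L j x \<subseteq> U \<and> dyadic_cube L j x \<inter> A \<noteq> {}"
          using x dyadic_cube_self by blast
        then show "x \<in> \<Union>G"
          unfolding G(4) by simp
      qed
      fix Q assume Q: "Q \<in> G"
      obtain j x where jx: "Q = dyadic_cube L j x" "Q \<subseteq> U" "Q \<inter> A \<noteq> {}"
        using bspec[OF G(5) Q] by (elim exE conjE) (rule that)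
      then obtain y where y: "y \<in> Q" "y \<in> A"
        by blast
      have "Q = dyadic_cube L j y"
        using jx(1) y(1) dyadic_cube_eq[of y L j x] by simp
      then have "emeasure lebesgue (E \<inter> Q) \<le> ennreal (1 / 2) * emeasure lebesgue Q"
        using y(2) by (simp add: A_def)
      moreover have "emeasure lebesgue (A \<inter> Q) \<le> emeasure lebesgue (E \<inter> Q)"
        using Eset G(2) Q by (intro emeasure_mono) (auto simp: A_def)
      ultimately show "emeasure lebesgue (A \<inter> Q) \<le> ennreal (1 / 2) * emeasure lebesgue (U \<inter> Q)"
        using jx(2) by (simp add: Int_absorb1)
    qed
    also have "emeasure lebesgue U = emeasure lebesgue A + emeasure lebesgue (U - A)"
      using plus_emeasure[of A lebesgue "U - A"] A Uset U(2) by (auto simp: Un_absorb1)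
    also have "ennreal (1 / 2) * \<dots> \<le> ennreal (1 / 2) * (emeasure lebesgue A + ennreal \<epsilon>)"
      using U(3) by (intro mult_left_mono add_left_mono) auto
    finally have le: "emeasure lebesgue A \<le> ennreal (1 / 2) * (emeasure lebesgue A + ennreal \<epsilon>)" .
    \<comment> \<open>Finiteness of the measure of \<open>A\<close> permits absorbing half of it
      into the left side, which leaves at most \<open>\<epsilon>\<close>.\<close>
    obtain r where r: "emeasure lebesgue A = ennreal r" "0 \<le> r"
      using finA by (cases "emeasure lebesgue A") auto
    have "ennreal (1 / 2) * (ennreal r + ennreal \<epsilon>) = ennreal ((r + \<epsilon>) / 2)"
      using eps r(2) by (subst ennreal_plus[symmetric], simp, simp, subst ennreal_mult[symmetric]) simp_all
    then have "ennreal r \<le> ennreal ((r + \<epsilon>) / 2)"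
      using le r(1) by simp
    then have "r \<le> (r + \<epsilon>) / 2"
      using eps r(2) by (subst (asm) ennreal_le_iff) simp_all
    then show ?thesis
      unfolding r(1) by (intro ennreal_leI) simp
  qed
  have "emeasure lebesgue A \<le> 0"
    by (rule ennreal_le_epsilon) (simp add: small)
  then have "emeasure lebesgue A = 0"
    by simp
  then show ?thesis
    unfolding A_def[symmetric] using A by (rule null_setsI)
qed

subsection \<open>Decay of the level sets of a BMO function\<close>

text \<open>Local integrability gives measurability of the restrictions to balls, and
  \<open>u\<close> is their pointwise limit.\<close>

lemma BMO_measurable:
  fixes u :: "real ^ 'n \<Rightarrow> real"
  assumes "u \<in> BMO"
  shows "u \<in> borel_measurable lebesgue"
proof (rule borel_measurable_LIMSEQ_real)
  fix x :: "real ^ 'n"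
  obtain k :: nat where k: "norm x \<le> real k"
    using real_arch_simple by blast
  have "eventually (\<lambda>n. indicat_real (cball 0 (real n)) x *\<^sub>R u x = u x) sequentially"
    using eventually_ge_at_top[of k]
    by eventually_elim (use k in \<open>simp add: indicator_def\<close>)
  then show "(\<lambda>n. indicat_real (cball 0 (real n)) x *\<^sub>R u x) \<longlonglongrightarrow> u x"
    by (rule tendsto_eventually)
next
  fix n
  have "u absolutely_integrable_on cball 0 (real n)"
    using assms by (simp add: BMO_def locally_integrable_def)
  then show "(\<lambda>x. indicat_real (cball 0 (real n)) x *\<^sub>R u x) \<in> borel_measurable lebesgue"
    unfolding set_integrable_def by (rule borel_measurable_integrable)
qed

lemma is_cube_emeasure:
  assumes "is_cube C"
  shows "\<exists>v>0. emeasure lebesgue C = ennreal v"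
proof -
  obtain a b l where "0 < l" "\<forall>i. b $ i - a $ i = l" "C = cbox a b"
    using assms unfolding is_cube_def by blast
  then show ?thesis
    using emeasure_cart_cube(2)[of l b a] by (intro exI[of _ "l ^ CARD('a)"]) simp
qed

text \<open>Restricting the double integral over \<open>C\<close> to \<open>x\<close> in
  \<open>A\<close> and \<open>z\<close> in \<open>A'\<close> leaves an integrand of at least
  \<open>c\<close>. This is the only way in which the BMO norm is exploited: two level sets at
  distant heights cannot both fill much of a cube.\<close>

lemma bmo_norm_separated:
  assumes C: "is_cube C" and sets: "A \<in> sets lebesgue" "A' \<in> sets lebesgue"
    and sub: "A \<subseteq> C" "A' \<subseteq> C"
    and sep: "\<And>x z. x \<in> A \<Longrightarrow> z \<in> A' \<Longrightarrow> c \<le> \<bar>u z - u x\<bar>"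
  shows "ennreal c * emeasure lebesgue A' * emeasure lebesgue A
    \<le> bmo_norm u * (emeasure lebesgue C)\<^sup>2"
proof -
  let ?I = "\<integral>\<^sup>+x\<in>C. (\<integral>\<^sup>+z\<in>C. ennreal \<bar>u z - u x\<bar> \<partial>lebesgue) \<partial>lebesgue"
  obtain v where v: "0 < v" "emeasure lebesgue C = ennreal v"
    using is_cube_emeasure[OF C] by blast
  have inner: "ennreal c * emeasure lebesgue A' \<le> (\<integral>\<^sup>+z\<in>C. ennreal \<bar>u z - u x\<bar> \<partial>lebesgue)"
    if x: "x \<in> A" for x
  proof -
    have "ennreal c * emeasure lebesgue A' = (\<integral>\<^sup>+z. ennreal c * indicator A' z \<partial>lebesgue)"
      using sets by (simp only: nn_integral_cmult_indicator)
    also have "\<dots> \<le> (\<integral>\<^sup>+z\<in>C. ennreal \<bar>u z - u x\<bar> \<partial>lebesgue)"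
      using sub(2) sep[OF x] by (intro nn_integral_mono) (auto simp: indicator_def intro: ennreal_leI)
    finally show ?thesis .
  qed
  have "ennreal c * emeasure lebesgue A' * emeasure lebesgue A
      = (\<integral>\<^sup>+x. (ennreal c * emeasure lebesgue A') * indicator A x \<partial>lebesgue)"
    using sets by (simp only: nn_integral_cmult_indicator)
  also have "\<dots> \<le> ?I"
    using sub(1) inner by (intro nn_integral_mono) (auto simp: indicator_def)
  \<comment> \<open>The normalising factor cancels in \<open>ennreal\<close> because the volume of
    \<open>C\<close> is positive and finite.\<close>
  also have "?I = (1 / (emeasure lebesgue C)\<^sup>2 * ?I) * (emeasure lebesgue C)\<^sup>2"
  proof -
    have "1 / (ennreal v)\<^sup>2 * (ennreal v)\<^sup>2 = 1"
      using v(1) by (simp add: ennreal_power divide_ennreal ennreal_mult[symmetric] flip: ennreal_1)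
    moreover have "1 / (ennreal v)\<^sup>2 * X * (ennreal v)\<^sup>2 = (1 / (ennreal v)\<^sup>2 * (ennreal v)\<^sup>2) * X" for X
      by (simp only: mult_ac)
    ultimately show ?thesis
      unfolding v(2) by simp
  qed
  also have "\<dots> \<le> bmo_norm u * (emeasure lebesgue C)\<^sup>2"
    unfolding bmo_norm_def using C by (intro mult_right_mono SUP_upper) auto
  finally show ?thesis .
qed

text \<open>If a lower set \<open>R r\<close> and a higher set \<open>T s\<close> with
  \<open>r < s\<close> both had positive measure, a large cube would see both, against
  \<open>bmo_norm_separated\<close>. So one of them is null, and the constant is the supremum of the
  heights \<open>r\<close> with \<open>R r\<close> null. This settles norm zero, where the decay
  estimate does not apply.\<close>

lemma bmo_norm_0_imp_AE_const:
  fixes u :: "real ^ 'n \<Rightarrow> real"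
  assumes u: "u \<in> borel_measurable lebesgue" and "bmo_norm u = 0"
  shows "\<exists>c. AE x in lebesgue. u x = c"
proof -
  define R where "R r = {x. u x \<le> r}" for r
  define T where "T s = {x. s \<le> u x}" for s
  have R [measurable]: "R r \<in> sets lebesgue" for r
    using borel_measurable_le[OF u, of "\<lambda>_. r"] by (simp add: R_def)
  have T [measurable]: "T s \<in> sets lebesgue" for s
    using borel_measurable_le[OF _ u, of "\<lambda>_. s"] by (simp add: T_def)
  \<comment> \<open>The shift to \<open>Suc n\<close> keeps the side positive at
    \<open>n = 0\<close>, as \<open>is_cube\<close> demands.\<close>
  define C :: "nat \<Rightarrow> (real ^ 'n) set"
    where "C n = cbox (\<chi> i. - real (Suc n)) (\<chi> i. real (Suc n))" for n
  have cube: "is_cube (C n)" for n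
    unfolding is_cube_def C_def
    by (intro exI[of _ "\<chi> i. - real (Suc n)"] exI[of _ "\<chi> i. real (Suc n)"] exI[of _ "2 * real (Suc n)"]) simp
  have C_mono: "C m \<subseteq> C n" if "m \<le> n" for m n
  proof
    fix x assume x: "x \<in> C m"
    have "- real (Suc n) \<le> x $ i \<and> x $ i \<le> real (Suc n)" for i
    proof -
      have "- real (Suc m) \<le> x $ i" "x $ i \<le> real (Suc m)"
        using x by (simp_all add: C_def mem_box_cart)
      then show ?thesis
        using that by simp
    qed
    then show "x \<in> C n"
      by (simp add: C_def mem_box_cart)
  qed
  have C_UN: "(\<Union>n. C n) = UNIV"
  proof -
    have "\<exists>n. x \<in> C n" for x
    proof -
      obtain n where n: "norm x \<le> real n"
        using real_arch_simple by blast
      have "- real (Suc n) \<le> x $ i \<and> x $ i \<le> real (Suc n)" for i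
        using component_le_norm_cart[of x i] n by simp linarith
      then have "x \<in> C n"
        by (simp add: C_def mem_box_cart)
      then show ?thesis ..
    qed
    then show ?thesis
      by blast
  qed
  have local: "\<exists>n. S \<inter> C n \<notin> null_sets lebesgue" if "S \<notin> null_sets lebesgue" for S
  proof (rule ccontr)
    assume "\<not> ?thesis"
    then have "(\<Union>n. S \<inter> C n) \<in> null_sets lebesgue"
      by (intro null_sets_UN) blast
    then show False
      using that C_UN by (simp flip: Int_UN_distrib)
  qed
  have dichotomy: "R r \<in> null_sets lebesgue \<or> T s \<in> null_sets lebesgue" if "r < s" for r s
  proof (rule ccontr)
    assume "\<not> ?thesis"
    then obtain m n where mn: "R r \<inter> C m \<notin> null_sets lebesgue" "T s \<inter> C n \<notin> null_sets lebesgue"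
      using local by meson
    define k where "k = max m n"
    have C_sets: "C i \<in> sets lebesgue" for i
      by (simp add: C_def)
    have sets: "R r \<inter> C k \<in> sets lebesgue" "T s \<inter> C k \<in> sets lebesgue"
      using C_sets R T by blast+
    have "R r \<inter> C k \<notin> null_sets lebesgue"
      using null_sets_subset[OF _ sets.Int[OF R C_sets], of "R r \<inter> C k" r m] C_mono[of m k] mn(1)
      by (auto simp: k_def)
    moreover have "T s \<inter> C k \<notin> null_sets lebesgue"
      using null_sets_subset[OF _ sets.Int[OF T C_sets], of "T s \<inter> C k" s n] C_mono[of n k] mn(2)
      by (auto simp: k_def)
    ultimately have pos: "emeasure lebesgue (R r \<inter> C k) \<noteq> 0" "emeasure lebesgue (T s \<inter> C k) \<noteq> 0"
      using sets by blast+
    have "ennreal (s - r) * emeasure lebesgue (T s \<inter> C k) * emeasure lebesgue (R r \<inter> C k)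
        \<le> bmo_norm u * (emeasure lebesgue (C k))\<^sup>2"
      by (rule bmo_norm_separated[OF cube sets]) (auto simp: R_def T_def)
    then have "ennreal (s - r) * emeasure lebesgue (T s \<inter> C k) * emeasure lebesgue (R r \<inter> C k) = 0"
      unfolding assms(2) by (simp only: mult_zero_left le_zero_eq)
    then show False
      using pos that by (simp only: mult_eq_0_iff) (simp add: ennreal_eq_0_iff)
  qed
  have UNIV: "(UNIV :: (real ^ 'n) set) \<notin> null_sets lebesgue"
    by (simp add: null_sets_def)
  define S where "S = {r. R r \<in> null_sets lebesgue}"
  \<comment> \<open>If \<open>S\<close> were empty, every \<open>T s\<close> would be null and the
    whole space with them; boundedness of \<open>S\<close> follows in the same way from the sets
    \<open>R\<close>.\<close>
  have "S \<noteq> {}"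
  proof
    assume "S = {}"
    then have "T s \<in> null_sets lebesgue" for s
      using dichotomy[of "s - 1" s] by (auto simp: S_def)
    then have "(\<Union>n. T (- real n)) \<in> null_sets lebesgue"
      by (intro null_sets_UN) blast
    moreover have "(\<Union>n. T (- real n)) = UNIV"
      by (auto simp: T_def) (metis minus_le_iff real_arch_simple)
    ultimately show False
      using UNIV by simp
  qed
  have bdd: "bdd_above S"
  proof -
    have "\<exists>n. real n \<notin> S"
    proof (rule ccontr)
      assume "\<not> ?thesis"
      then have "(\<Union>n. R (real n)) \<in> null_sets lebesgue"
        by (intro null_sets_UN) (auto simp: S_def)
      moreover have "(\<Union>n. R (real n)) = UNIV"
        by (auto simp: R_def intro: real_arch_simple)
      ultimately show False
        using UNIV by simp
    qed
    then obtain n where n: "R (real n) \<notin> null_sets lebesgue"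
      by (auto simp: S_def)
    have "r \<le> real n" if "r \<in> S" for r
    proof (rule ccontr)
      assume "\<not> r \<le> real n"
      then have "R (real n) \<subseteq> R r"
        by (auto simp: R_def)
      then show False
        using n that null_sets_subset[of "R r" lebesgue "R (real n)"] by (auto simp: S_def)
    qed
    then show ?thesis
      by (rule bdd_aboveI)
  qed
  define c where "c = Sup S"
  have "R (c - 1 / real (Suc n)) \<in> null_sets lebesgue" for n
  proof -
    have "c - 1 / real (Suc n) < Sup S"
      by (simp add: c_def)
    then obtain r where r: "r \<in> S" "c - 1 / real (Suc n) < r"
      using less_cSupD[OF \<open>S \<noteq> {}\<close>] by blast
    then have "R (c - 1 / real (Suc n)) \<subseteq> R r"
      by (auto simp: R_def)
    then show ?thesis
      using r(1) null_sets_subset[of "R r" lebesgue] by (auto simp: S_def)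
  qed
  moreover have "T (c + 1 / real (Suc n)) \<in> null_sets lebesgue" for n
  proof -
    \<comment> \<open>The intermediate height \<open>c + d / 2\<close> exceeds the supremum, so its
      lower set is not null and the dichotomy makes \<open>T (c + d)\<close> null.\<close>
    define d where "d = 1 / real (Suc n)"
    have "0 < d"
      by (simp add: d_def)
    then have "c + d / 2 \<notin> S"
      using cSup_upper[OF _ bdd, of "c + d / 2"] by (auto simp: c_def)
    then show ?thesis
      using dichotomy[of "c + d / 2" "c + d"] \<open>0 < d\<close> unfolding S_def d_def[symmetric] by auto
  qed
  ultimately have null: "(\<Union>n. R (c - 1 / real (Suc n)) \<union> T (c + 1 / real (Suc n))) \<in> null_sets lebesgue"
    by (intro null_sets_UN) auto
  have "AE x in lebesgue. u x = c"
  proof (rule AE_I'[OF null], rule subsetI)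
    fix x assume "x \<in> {x \<in> space lebesgue. u x \<noteq> c}"
    then have "0 < \<bar>u x - c\<bar>"
      by simp
    then obtain n where "1 / real (Suc n) < \<bar>u x - c\<bar>"
      using nat_approx_posE by blast
    then have "x \<in> R (c - 1 / real (Suc n)) \<union> T (c + 1 / real (Suc n))"
      by (auto simp: R_def T_def)
    then show "x \<in> (\<Union>n. R (c - 1 / real (Suc n)) \<union> T (c + 1 / real (Suc n)))"
      by blast
  qed
  then show ?thesis ..
qed

lemma level_set_sets:
  assumes "u \<in> borel_measurable lebesgue"
  shows "{x :: real ^ 'n. t < \<bar>u x :: real\<bar>} \<in> sets lebesgue"
proof -
  have "(\<lambda>x. \<bar>u x\<bar>) \<in> borel_measurable lebesgue"
    using assms by measurable
  from borel_measurable_less[OF _ this, of "\<lambda>_. t"] show ?thesis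
    by simp
qed

section \<open>Global John-Nirenberg decay\<close>

text \<open>Let a selected cube \<open>Q\<close> have parent \<open>D\<close> of volume
  \<open>d\<close>. Then \<open>D - E\<close> has measure at least \<open>d / 2\<close>, while
  \<open>E\<close> fills more than \<open>d / 2 ^ (N + 1)\<close> of \<open>Q\<close>. On
  \<open>A \<inter> Q\<close> and \<open>D - E\<close> the values of \<open>u\<close> differ by at
  least \<open>K * B\<close>, so \<open>A \<inter> Q\<close> has measure at most
  \<open>2 * d / K\<close>. The choice \<open>K = 2 ^ (N + 3)\<close> makes this
  \<open>d / 2 ^ (N + 2)\<close>, less than half of what \<open>E\<close> has in
  \<open>Q\<close>.\<close>

lemma bmo_level_halving:
  fixes u :: "real ^ 'n \<Rightarrow> real"
  assumes u: "u \<in> borel_measurable lebesgue"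
    and B: "bmo_norm u = ennreal B" "0 < B"
    and fin: "emeasure lebesgue {x. t < \<bar>u x\<bar>} < \<infinity>"
  shows "emeasure lebesgue {x. t + 2 ^ (CARD('n) + 3) * B < \<bar>u x\<bar>}
    \<le> ennreal (1 / 2) * emeasure lebesgue {x. t < \<bar>u x\<bar>}"
proof -
  define N where "N = CARD('n)"
  define K :: real where "K = 2 ^ (N + 3)"
  define E where "E = {x. t < \<bar>u x\<bar>}"
  define A where "A = {x. t + K * B < \<bar>u x\<bar>}"
  have sets: "E \<in> sets lebesgue" "A \<in> sets lebesgue"
    using level_set_sets[OF u] by (auto simp: E_def A_def)
  have E: "E \<in> lmeasurable"
    using sets fin by (auto simp: fmeasurable_def E_def)
  have "A \<subseteq> E"
    using B by (auto simp: A_def E_def K_def) (smt (verit) mult_pos_pos zero_less_power)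
  \<comment> \<open>Since \<open>L \<ge> 1\<close>, the coarsest cubes have volume
    \<open>L ^ N \<ge> L\<close>, more than twice the measure of \<open>E\<close>. None of them can
    be more than half filled, so each selected cube has a parent.\<close>
  define L where "L = 2 * measure lebesgue E + 1"
  have L: "1 \<le> L"
    by (simp add: L_def)
  then have L0: "0 < L"
    by simp
  define P where "P Q \<longleftrightarrow> \<not> emeasure lebesgue (E \<inter> Q) \<le> ennreal (1 / 2) * emeasure lebesgue Q" for Q
  obtain F where F: "countable F" "F \<subseteq> sets lebesgue" "disjoint F"
    "\<Union>F = {x. \<exists>j. P (dyadic_cube L j x)}"
    "\<forall>Q\<in>F. \<exists>j x. Q = dyadic_cube L j x \<and> P Q \<and> (\<forall>i<j. \<not> P (dyadic_cube L i x))"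
    using maximal_dyadic_cubes[of P L] by (elim exE conjE) (rule that)
  have UF: "\<Union>F \<in> sets lebesgue"
    using F by (intro sets.countable_Union)
  have null: "E - \<Union>F \<in> null_sets lebesgue"
  proof -
    have "E - \<Union>F = {x \<in> E. \<forall>j. emeasure lebesgue (E \<inter> dyadic_cube L j x)
      \<le> ennreal (1 / 2) * emeasure lebesgue (dyadic_cube L j x)}"
      unfolding F(4) P_def by blast
    then show ?thesis
      using null_sets_dyadic_sparse[OF L0 E] by simp
  qed
  have "emeasure lebesgue A = emeasure lebesgue (A \<inter> \<Union>F)"
  proof -
    have "A = (A \<inter> \<Union>F) \<union> (A - \<Union>F)"
      by blast
    moreover have "A - \<Union>F \<in> null_sets lebesgue"
      using null_sets_subset[OF null, of "A - \<Union>F"] \<open>A \<subseteq> E\<close> sets UF by blast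
    ultimately show ?thesis
      using emeasure_Un_null_set[of "A \<inter> \<Union>F" lebesgue "A - \<Union>F"] sets UF by (metis sets.Int)
  qed
  also have "\<dots> \<le> ennreal (1 / 2) * emeasure lebesgue E"
  proof (rule emeasure_le_disjoint_cover[OF F(1-3) sets.Int[OF sets(2) UF] sets(1)])
    fix Q assume QF: "Q \<in> F"
    obtain j x where Q: "Q = dyadic_cube L j x" "P Q" "\<forall>i<j. \<not> P (dyadic_cube L i x)"
      using bspec[OF F(5) QF] by (elim exE conjE) (rule that)
    have "j \<noteq> 0"
    proof
      assume "j = 0"
      then have "emeasure lebesgue Q = ennreal (L ^ N)"
        using emeasure_dyadic_cube[OF L0, of 0 x] Q(1) by (simp only: N_def) simp
      moreover have "L \<le> L ^ N"
        using L by (simp add: self_le_power N_def)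
      moreover have "emeasure lebesgue (E \<inter> Q) \<le> ennreal (measure lebesgue E)"
        using E emeasure_mono[of "E \<inter> Q" E lebesgue] sets by (simp add: emeasure_eq_measure2)
      moreover have "ennreal (measure lebesgue E) \<le> ennreal (1 / 2 * L ^ N)"
        using \<open>L \<le> L ^ N\<close> by (intro ennreal_leI) (simp add: L_def)
      moreover have "ennreal (1 / 2 * L ^ N) = ennreal (1 / 2) * ennreal (L ^ N)"
        using L by (intro ennreal_mult) simp_all
      ultimately show False
        using Q(2) unfolding P_def by (metis order_trans)
    qed
    then obtain k where k: "j = Suc k"
      using not0_implies_Suc by blast
    define D where "D = dyadic_cube L k x"
    define d where "d = (L / 2 ^ k) ^ N"
    have "0 < d"
      using L0 by (simp add: d_def)
    have "Q \<subseteq> D"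
      unfolding Q(1) D_def using k by (intro dyadic_cube_antimono) simp
    \<comment> \<open>The parent is half-open; its closed hull has the same volume and is admissible
      in the BMO norm.\<close>
    obtain a b where ab: "\<forall>i. b $ i - a $ i = L / 2 ^ k" "D \<subseteq> cbox a b"
      unfolding D_def using dyadic_cube_sandwich[OF L0] by metis
    have mC: "emeasure lebesgue (cbox a b) = ennreal d"
      unfolding d_def N_def using emeasure_cart_cube(2)[OF _ ab(1)] L0 by simp
    have cube: "is_cube (cbox a b)"
      unfolding is_cube_def using ab(1) L0 by (intro exI[of _ a] exI[of _ b] exI[of _ "L / 2 ^ k"]) simp
    have mD: "emeasure lebesgue D = ennreal d"
      unfolding D_def d_def N_def by (rule emeasure_dyadic_cube[OF L0])
    have mQ: "emeasure lebesgue Q = ennreal (d / 2 ^ N)"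
      unfolding Q(1) d_def N_def emeasure_dyadic_cube[OF L0] k
      by (simp add: power_divide power_mult_distrib mult.commute)
    have Dset: "D \<in> lmeasurable" and Qset: "Q \<in> lmeasurable"
      using mD mQ QF F(2) by (auto intro!: fmeasurableI simp: D_def)
    have lm: "E \<inter> D \<in> lmeasurable" "E \<inter> Q \<in> lmeasurable" "A \<inter> Q \<in> lmeasurable" "D - E \<in> lmeasurable"
      using fmeasurable_Int_fmeasurable[OF Dset sets(1)] fmeasurable_Int_fmeasurable[OF Qset sets(1)]
        fmeasurable_Int_fmeasurable[OF Qset sets(2)] fmeasurable_Diff[OF Dset sets(1)]
      by (simp_all only: Int_commute)
    define \<alpha> where "\<alpha> = measure lebesgue (A \<inter> Q)"
    define \<beta> where "\<beta> = measure lebesgue (D - E)"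
    define \<eta> where "\<eta> = measure lebesgue (E \<inter> Q)"
    have nonneg: "0 \<le> \<alpha>" "0 \<le> \<beta>" "0 \<le> \<eta>"
      by (simp_all add: \<alpha>_def \<beta>_def \<eta>_def)
    have "measure lebesgue D = d"
      using mD \<open>0 < d\<close> by (simp only: measure_def) simp
    moreover have "measure lebesgue D = \<beta> + measure lebesgue (E \<inter> D)"
      using measurable_measure_Diff[OF Dset lm(1)[THEN fmeasurableD]]
      by (simp add: \<beta>_def Diff_Int)
    moreover have "measure lebesgue (E \<inter> D) \<le> d / 2"
    proof -
      have "emeasure lebesgue (E \<inter> D) \<le> ennreal (1 / 2) * ennreal d"
        using Q(3) k mD by (auto simp: P_def D_def)
      also have "\<dots> = ennreal (d / 2)"
        using \<open>0 < d\<close> by (subst ennreal_mult[symmetric]) simp_all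
      finally show ?thesis
        using lm(1) \<open>0 < d\<close> by (simp only: emeasure_eq_measure2 ennreal_le_iff)
    qed
    ultimately have \<beta>: "d / 2 \<le> \<beta>"
      by linarith
    have \<eta>: "d / 2 ^ N / 2 < \<eta>"
    proof -
      have "ennreal (1 / 2) * ennreal (d / 2 ^ N) < ennreal \<eta>"
        using Q(2) lm(2) mQ unfolding P_def \<eta>_def by (simp only: emeasure_eq_measure2 not_le)
      moreover have "ennreal (1 / 2) * ennreal (d / 2 ^ N) = ennreal (d / 2 ^ N / 2)"
        using \<open>0 < d\<close> by (subst ennreal_mult[symmetric]) simp_all
      ultimately show ?thesis
        using \<open>0 < d\<close> by (simp add: ennreal_less_iff)
    qed
    have "ennreal (K * B) * emeasure lebesgue (A \<inter> Q) * emeasure lebesgue (D - E)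
        \<le> bmo_norm u * (emeasure lebesgue (cbox a b))\<^sup>2"
    proof (rule bmo_norm_separated[OF cube])
      show "K * B \<le> \<bar>u z - u x\<bar>" if "x \<in> D - E" "z \<in> A \<inter> Q" for x z
        using that by (auto simp: E_def A_def)
    qed (use lm ab(2) \<open>Q \<subseteq> D\<close> in auto)
    then have "ennreal (K * B) * ennreal \<alpha> * ennreal \<beta> \<le> ennreal B * (ennreal d)\<^sup>2"
      using lm B(1) mC by (simp only: emeasure_eq_measure2 \<alpha>_def \<beta>_def)
    also have "ennreal (K * B) * ennreal \<alpha> * ennreal \<beta> = ennreal (K * B * \<alpha> * \<beta>)"
      using nonneg B(2) by (simp add: ennreal_mult' K_def)
    also have "ennreal B * (ennreal d)\<^sup>2 = ennreal (B * d\<^sup>2)"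
      using B(2) \<open>0 < d\<close> by (simp add: ennreal_power ennreal_mult)
    finally have "K * B * \<alpha> * \<beta> \<le> B * d\<^sup>2"
      using B(2) by (subst (asm) ennreal_le_iff) simp_all
    then have "B * (K * \<alpha> * \<beta>) \<le> B * d\<^sup>2"
      by (simp add: mult_ac)
    then have le: "K * \<alpha> * \<beta> \<le> d\<^sup>2"
      using B(2) by simp
    have "K * \<alpha> * (d / 2) \<le> K * \<alpha> * \<beta>"
      using \<beta> nonneg by (intro mult_left_mono) (simp_all add: K_def)
    then have "d * (K * \<alpha> / 2) \<le> d * d"
      using le by (simp add: power2_eq_square mult_ac)
    then have "K * \<alpha> / 2 \<le> d"
      using \<open>0 < d\<close> by simp
    define w where "w = d / 2 ^ N"
    have "\<alpha> \<le> w / 4"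
      using \<open>K * \<alpha> / 2 \<le> d\<close> by (simp add: K_def w_def power_add field_simps)
    then have "\<alpha> \<le> 1 / 2 * \<eta>"
      using \<eta> unfolding w_def[symmetric] by linarith
    then have "ennreal \<alpha> \<le> ennreal (1 / 2 * \<eta>)"
      by (rule ennreal_leI)
    also have "\<dots> = ennreal (1 / 2) * ennreal \<eta>"
      using nonneg by (intro ennreal_mult) simp_all
    finally have "emeasure lebesgue (A \<inter> Q) \<le> ennreal (1 / 2) * emeasure lebesgue (E \<inter> Q)"
      using lm unfolding \<alpha>_def \<eta>_def by (simp only: emeasure_eq_measure2)
    moreover have "A \<inter> \<Union>F \<inter> Q = A \<inter> Q"
      using QF by blast
    ultimately show "emeasure lebesgue (A \<inter> \<Union>F \<inter> Q) \<le> ennreal (1 / 2) * emeasure lebesgue (E \<inter> Q)"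
      by simp
  qed simp
  finally show ?thesis
    by (simp only: A_def E_def K_def N_def)
qed

lemma bmo_level_halving_iter:
  fixes u :: "real ^ 'n \<Rightarrow> real"
  assumes u: "u \<in> borel_measurable lebesgue"
    and B: "bmo_norm u = ennreal B" "0 < B"
    and fin: "emeasure lebesgue {x. t < \<bar>u x\<bar>} < \<infinity>"
  shows "emeasure lebesgue {x. t + real k * (2 ^ (CARD('n) + 3) * B) < \<bar>u x\<bar>}
    \<le> ennreal ((1 / 2) ^ k) * emeasure lebesgue {x. t < \<bar>u x\<bar>}"
proof (induction k)
  case 0
  then show ?case
    by simp
next
  case (Suc k)
  define s where "s = t + real k * (2 ^ (CARD('n) + 3) * B)"
  \<comment> \<open>The halving step asks for finiteness at the current height; the induction
    hypothesis passes it on from \<open>t\<close>.\<close>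
  have "emeasure lebesgue {x. s < \<bar>u x\<bar>} < \<infinity>"
    using Suc.IH fin unfolding s_def[symmetric]
    by (auto simp: ennreal_mult_less_top simp del: emeasure_completion elim!: le_less_trans)
  then have "emeasure lebesgue {x. s + 2 ^ (CARD('n) + 3) * B < \<bar>u x\<bar>}
      \<le> ennreal (1 / 2) * emeasure lebesgue {x. s < \<bar>u x\<bar>}"
    by (rule bmo_level_halving[OF u B])
  also have "\<dots> \<le> ennreal (1 / 2) * (ennreal ((1 / 2) ^ k) * emeasure lebesgue {x. t < \<bar>u x\<bar>})"
    using Suc.IH unfolding s_def by (intro mult_left_mono) simp_all
  also have "\<dots> = ennreal ((1 / 2) ^ Suc k) * emeasure lebesgue {x. t < \<bar>u x\<bar>}"
    by (subst mult.assoc[symmetric], subst ennreal_mult[symmetric]) simp_all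
  also have "s + 2 ^ (CARD('n) + 3) * B = t + real (Suc k) * (2 ^ (CARD('n) + 3) * B)"
    by (simp add: s_def algebra_simps)
  finally show ?case .
qed

text \<open>The exponential decay of John and Nirenberg, weakened to a power for easy integration.\<close>

lemma bmo_level_decay:
  fixes u :: "real ^ 'n \<Rightarrow> real"
  assumes u: "u \<in> borel_measurable lebesgue"
    and B: "bmo_norm u = ennreal B" "0 < B"
    and fin: "emeasure lebesgue {x. B / 2 < \<bar>u x\<bar>} < \<infinity>"
    and r: "0 < r" and s: "B / 2 \<le> s"
  shows "emeasure lebesgue {x. s < \<bar>u x\<bar>}
    \<le> ennreal (4 * (r * 2 ^ (CARD('n) + 3) / ln 2) powr r * (B / s) powr r)
      * emeasure lebesgue {x. B / 2 < \<bar>u x\<bar>}"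
proof -
  define K :: real where "K = 2 ^ (CARD('n) + 3)"
  have K: "1 \<le> K"
    unfolding K_def by (rule one_le_power) simp
  have s0: "0 < s"
    using B s by linarith
  \<comment> \<open>The number of full halving steps of length \<open>K * B\<close> that fit between
    \<open>B / 2\<close> and \<open>s\<close>.\<close>
  define k where "k = nat \<lfloor>(s - B / 2) / (K * B)\<rfloor>"
  have KB: "0 < K * B"
    using K B by simp
  have nn: "0 \<le> (s - B / 2) / (K * B)"
    using s KB by simp
  then have k: "real k \<le> (s - B / 2) / (K * B)" "(s - B / 2) / (K * B) < real k + 1"
    unfolding k_def by linarith+
  define c where "c = ln 2 / K"
  have c: "0 < c" "c \<le> ln 2"
    using K by (auto simp: c_def field_simps mult_left_mono)
  have "B / 2 + real k * (K * B) \<le> s"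
    using k(1) KB by (simp add: pos_le_divide_eq)
  then have "emeasure lebesgue {x. s < \<bar>u x\<bar>} \<le> emeasure lebesgue {x. B / 2 + real k * (K * B) < \<bar>u x\<bar>}"
    by (intro emeasure_mono level_set_sets u) auto
  also have "\<dots> \<le> ennreal ((1 / 2) ^ k) * emeasure lebesgue {x. B / 2 < \<bar>u x\<bar>}"
    unfolding K_def by (rule bmo_level_halving_iter[OF u B fin])
  also have "\<dots> \<le> ennreal (4 * (r * K / ln 2) powr r * (B / s) powr r)
      * emeasure lebesgue {x. B / 2 < \<bar>u x\<bar>}"
  proof (intro mult_right_mono ennreal_leI)
    \<comment> \<open>Scaled so that \<open>r * y\<close> is the exponent \<open>c * s / B\<close>;
      then \<open>y \<le> exp y\<close> turns exponential into power decay of order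
      \<open>r\<close>.\<close>
    define y where "y = c * s / (B * r)"
    have y: "0 < y"
      using c s0 B r by (simp add: y_def)
    have "(1 / 2 :: real) ^ k = exp (- (real k * ln 2))"
      by (simp add: exp_minus exp_of_nat_mult power_one_over inverse_eq_divide)
    \<comment> \<open>One \<open>ln 2\<close> pays for the fractional step lost in the floor, the
      other for starting at \<open>B / 2\<close>, since \<open>c / 2 \<le> ln 2\<close>. Together
      they produce the factor 4.\<close>
    also have "\<dots> \<le> exp (- (c * s / B) + 2 * ln 2)"
    proof -
      have "(s - B / 2) / (K * B) * ln 2 \<le> (real k + 1) * ln 2"
        using k(2) by (intro mult_right_mono) simp_all
      moreover have "(s - B / 2) / (K * B) * ln 2 = c * s / B - c / 2"
        using B K by (simp add: c_def field_simps)
      ultimately have "c * s / B - c / 2 \<le> real k * ln 2 + ln 2"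
        by (simp only: distrib_right mult_1)
      then have "- (real k * ln 2) \<le> - (c * s / B) + 2 * ln 2"
        using c by linarith
      then show ?thesis
        by simp
    qed
    also have "\<dots> = 4 * inverse (exp (r * y))"
    proof -
      have "exp (2 * ln 2) = (4 :: real)"
        using exp_add[of "ln 2" "ln 2 :: real"] by simp
      moreover have "c * s / B = r * y"
        using r by (simp add: y_def)
      ultimately show ?thesis
        by (simp add: exp_diff divide_inverse)
    qed
    also have "\<dots> \<le> 4 * inverse (y powr r)"
    proof -
      have "y \<le> exp y"
        using exp_ge_add_one_self[of y] by linarith
      then have "y powr r \<le> exp y powr r"
        using y r by (intro powr_mono2) simp_all
      also have "\<dots> = exp (r * y)"
        by (simp add: powr_def)
      finally show ?thesis
        using y by (simp add: le_imp_inverse_le)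
    qed
    also have "inverse (y powr r) = (inverse y) powr r"
      using y by (simp add: powr_def ln_inverse exp_minus)
    also have "inverse y = (r * K / ln 2) * (B / s)"
      using K by (simp add: y_def c_def field_simps)
    also have "\<dots> powr r = (r * K / ln 2) powr r * (B / s) powr r"
      using r K B s0 by (intro powr_mult)
    finally show "(1 / 2) ^ k \<le> 4 * (r * K / ln 2) powr r * (B / s) powr r"
      by simp
  qed simp
  finally show ?thesis
    unfolding K_def .
qed

subsection \<open>Lorentz norms\<close>

lemma ennpowr_top [simp]: "ennpowr top a = top"
  by (simp add: ennpowr_def)

lemma ennpowr_ennreal: "0 \<le> x \<Longrightarrow> ennpowr (ennreal x) a = ennreal (x powr a)"
  by (simp add: ennpowr_def)

lemma ennpowr_0 [simp]: "ennpowr 0 a = 0"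
  by (simp add: ennpowr_def)

lemma ennpowr_1 [simp]: "ennpowr x 1 = x"
  by (cases x) (simp_all add: ennpowr_ennreal)

lemma ennpowr_mono:
  assumes "0 \<le> a" "x \<le> y"
  shows "ennpowr x a \<le> ennpowr y a"
proof (cases y)
  case (real s)
  then obtain r where "x = ennreal r" "0 \<le> r"
    using assms by (cases x) (auto simp: top_unique)
  with real show ?thesis
    using assms by (auto simp: ennpowr_ennreal intro!: ennreal_leI powr_mono2)
qed simp

text \<open>The mixed cases agree with the convention \<open>0 * top = 0\<close>, because powers
  keep both 0 and \<open>top\<close> fixed.\<close>

lemma ennpowr_mult: "ennpowr (x * y) a = ennpowr x a * ennpowr y a"
proof (cases x; cases y)
  fix r s assume "x = ennreal r" "0 \<le> r" "y = ennreal s" "0 \<le> s"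
  then show ?thesis
    by (simp add: ennpowr_ennreal powr_mult flip: ennreal_mult)
next
  fix r assume "x = ennreal r" "0 \<le> r" "y = top"
  then show ?thesis
    by (cases "r = 0") (simp_all add: ennpowr_ennreal ennreal_mult_top)
next
  fix r assume "x = top" "y = ennreal r" "0 \<le> r"
  then show ?thesis
    by (cases "r = 0") (simp_all add: ennpowr_ennreal ennreal_top_mult)
qed simp

lemma ennpowr_ennpowr: "ennpowr (ennpowr x a) b = ennpowr x (a * b)"
  by (cases x) (simp_all add: ennpowr_ennreal powr_powr)

text \<open>Superlevel sets of a monotone function are intervals. Applied to a power of a
  distribution function, this allows a Lorentz integral to be split additively.\<close>

lemma borel_measurable_antimono_ennreal:
  fixes f :: "real \<Rightarrow> ennreal"
  assumes "antimono f"
  shows "f \<in> borel_measurable borel"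
proof (rule borel_measurableI_greater)
  fix y
  have "is_interval {x. y < f x}"
    unfolding is_interval_1 using antimonoD[OF assms] by (auto intro: less_le_trans)
  then show "{x \<in> space borel. y < f x} \<in> sets borel"
    using real_interval_borel_measurable by simp
qed

lemma nn_integral_powr_from_0:
  assumes "0 < a" "0 \<le> b"
  shows "(\<integral>\<^sup>+t. ennreal (t powr (a - 1)) * indicator {0..b} t \<partial>lborel) = ennreal (b powr a / a)"
  using nn_integral_has_integral_lebesgue'[OF _ has_integral_powr_from_0[of "a - 1" b]] assms by simp

lemma nn_integral_powr_to_inf:
  assumes "0 < a" "0 < b"
  shows "(\<integral>\<^sup>+t. ennreal (t powr (- a - 1)) * indicator {b..} t \<partial>lborel) = ennreal (b powr (- a) / a)"
  using nn_integral_has_integral_lebesgue'[OF _ has_integral_powr_to_inf[of "- a - 1" b]] assms by simp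

lemma powr_less_iff_root:
  fixes t v q :: real
  assumes "0 < q" "0 \<le> t" "0 \<le> v"
  shows "t < v powr q \<longleftrightarrow> t powr (1 / q) < v"
proof
  assume "t < v powr q"
  then have "t powr (1 / q) < (v powr q) powr (1 / q)"
    using assms by (intro powr_less_mono2) simp_all
  then show "t powr (1 / q) < v"
    using assms by (simp add: powr_powr)
next
  assume "t powr (1 / q) < v"
  then have "(t powr (1 / q)) powr q < v powr q"
    using assms by (intro powr_less_mono2) simp_all
  then show "t < v powr q"
    using assms by (simp add: powr_powr)
qed

lemma powr_level_sets:
  assumes "u \<in> borel_measurable lebesgue"
  shows "{x :: real ^ 'n. t < \<bar>u x :: real\<bar> powr q} \<in> sets lebesgue"
proof -
  have "(\<lambda>x. \<bar>u x\<bar> powr q) \<in> borel_measurable lebesgue"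
    using assms by measurable
  from borel_measurable_less[OF _ this, of "\<lambda>_. t"] show ?thesis
    by simp
qed

text \<open>Thus truncation at \<open>B\<close> leaves the distribution function unchanged below
  \<open>B powr q\<close> and makes it vanish from there on.\<close>

lemma min_powr_less_iff:
  fixes t v B q :: real
  assumes "0 < q" "0 \<le> v" "0 \<le> B"
  shows "t < \<bar>min v B\<bar> powr q \<longleftrightarrow> t < v powr q \<and> t < B powr q"
proof (cases "v \<le> B")
  case True
  then have "v powr q \<le> B powr q"
    using assms by (intro powr_mono2) simp_all
  then show ?thesis
    using True assms by (auto simp: min_def)
next
  case False
  then have "B powr q \<le> v powr q"
    using assms by (intro powr_mono2) simp_all
  then show ?thesis
    using False assms by (auto simp: min_def)
qed

text \<open>Height \<open>t\<close> for the \<open>q\<close>-th power is height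
  \<open>t powr (1 / q)\<close> for \<open>\<bar>u\<bar>\<close>. Decay of order
  \<open>2 * q\<close> in the latter is order 2 in \<open>t\<close>, which beats the weight
  \<open>t\<close> of the weak norm and, after the power \<open>a\<close>, leaves
  \<open>t powr (- a - 1)\<close>, integrable at infinity.\<close>

lemma bmo_powr_level_decay:
  fixes u :: "real ^ 'n \<Rightarrow> real"
  assumes u: "u \<in> borel_measurable lebesgue"
    and B: "bmo_norm u = ennreal B" "0 < B"
    and fin: "emeasure lebesgue {x. B / 2 < \<bar>u x\<bar>} < \<infinity>"
    and q: "0 < q" and t: "(B / 2) powr q \<le> t"
  shows "emeasure lebesgue {x. t < \<bar>u x\<bar> powr q}
    \<le> ennreal (4 * (2 * q * 2 ^ (CARD('n) + 3) / ln 2) powr (2 * q) * B powr (2 * q) * t powr (- 2))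
      * emeasure lebesgue {x. B / 2 < \<bar>u x\<bar>}"
proof -
  have "0 < (B / 2) powr q"
    using B by simp
  then have t0: "0 < t"
    using t by linarith
  have "((B / 2) powr q) powr (1 / q) \<le> t powr (1 / q)"
    using t q by (intro powr_mono2) simp_all
  then have s: "B / 2 \<le> t powr (1 / q)"
    using q B by (simp add: powr_powr)
  have eq: "{x. t < \<bar>u x\<bar> powr q} = {x. t powr (1 / q) < \<bar>u x\<bar>}"
    using powr_less_iff_root[of q t] q t0 by simp
  have pow: "(B / t powr (1 / q)) powr (2 * q) = B powr (2 * q) * t powr (- 2)"
  proof -
    have "(B / t powr (1 / q)) powr (2 * q) = B powr (2 * q) / (t powr (1 / q)) powr (2 * q)"
      using B by (intro powr_divide)
    also have "(t powr (1 / q)) powr (2 * q) = t powr 2"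
      unfolding powr_powr using q by simp
    finally show ?thesis
      by (simp only: powr_minus divide_inverse)
  qed
  have "0 < 2 * q"
    using q by simp
  from bmo_level_decay[OF u B fin this s] show ?thesis
    by (simp only: eq pow mult.assoc)
qed

lemma lorentz_norm_infinity:
  "lorentz_norm q \<infinity> UNIV f =
    ennpowr (SUP t\<in>{0<..}. ennreal t * emeasure lebesgue {x. t < \<bar>f x\<bar> powr q}) (1 / q)"
  by (simp only: lorentz_norm_def UNIV_I simp_thms if_True)

lemma lorentz_norm_finite:
  assumes "\<gamma> \<noteq> \<infinity>"
  shows "lorentz_norm q \<gamma> UNIV f =
    ennpowr (\<integral>\<^sup>+t\<in>{0<..}. (ennpowr (emeasure lebesgue {x. t < \<bar>f x\<bar> powr q}) (enn2real \<gamma> / q) *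
      ennreal (t powr (enn2real \<gamma> / q - 1))) \<partial>lborel) (1 / enn2real \<gamma>)"
  using assms by (simp only: lorentz_norm_def UNIV_I simp_thms if_False)

section \<open>First inequality: removing the truncation\<close>

text \<open>Below \<open>B powr q\<close> the distribution functions \<open>\<phi>\<close> of
  \<open>u\<close> and \<open>\<psi>\<close> of the truncation agree; above it \<open>\<phi>\<close>
  is a decaying multiple of \<open>\<mu>\<close>. In turn \<open>\<mu> \<le> \<psi> t\<close> for
  all \<open>t\<close> up to \<open>(B / 2) powr q\<close>, so the truncated norm controls
  \<open>\<mu>\<close>. The constant is fixed before \<open>u\<close>.\<close>

lemma lorentz_le_truncation:
  fixes q :: real and \<gamma> :: ennreal
  assumes q: "0 < q" and \<gamma>: "0 < \<gamma>"
  shows "\<exists>C>0. \<forall>(u :: real ^ 'n \<Rightarrow> real) B. u \<in> borel_measurable lebesgue \<longrightarrow>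
    bmo_norm u = ennreal B \<longrightarrow> 0 < B \<longrightarrow>
    lorentz_norm q \<gamma> UNIV u \<le> ennreal C * lorentz_norm q \<gamma> UNIV (\<lambda>x. min \<bar>u x\<bar> B)"
proof -
  define D :: real where "D = 4 * (2 * q * 2 ^ (CARD('n) + 3) / ln 2) powr (2 * q)"
  have D: "0 < D"
    using q by (simp add: D_def)
  define g where "g = enn2real \<gamma>"
  define a where "a = g / q"
  \<comment> \<open>The summand 1 accounts for heights below \<open>B powr q\<close>, the other for
    the tail; the powers of 2 come from comparing \<open>B\<close> with \<open>B / 2\<close>, and
    the outer root is that of the norm.\<close>
  define C where "C = (if \<gamma> = \<infinity> then (1 + D * 2 powr q) powr (1 / q)
    else (1 + D powr a * 2 powr g) powr (1 / g))"
  have "0 < C"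
    using D by (auto simp: C_def add_pos_pos intro!: powr_gt_zero[THEN iffD2] less_imp_neq[THEN not_sym])
  moreover have "lorentz_norm q \<gamma> UNIV u \<le> ennreal C * lorentz_norm q \<gamma> UNIV (\<lambda>x. min \<bar>u x\<bar> B)"
    if u: "u \<in> borel_measurable lebesgue" and B: "bmo_norm u = ennreal B" "0 < B"
    for u :: "real ^ 'n \<Rightarrow> real" and B
  proof -
    define \<phi> where "\<phi> t = emeasure lebesgue {x. t < \<bar>u x\<bar> powr q}" for t
    define \<psi> where "\<psi> t = emeasure lebesgue {x. t < \<bar>min (\<bar>u x\<bar>) B\<bar> powr q}" for t
    define \<mu> where "\<mu> = emeasure lebesgue {x. B / 2 < \<bar>u x\<bar>}"
    have f_meas: "(\<lambda>x. min \<bar>u x\<bar> B) \<in> borel_measurable lebesgue"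
      using u by measurable
    have eq: "\<phi> t = \<psi> t" if "t < B powr q" for t
      unfolding \<phi>_def \<psi>_def using that min_powr_less_iff[OF q] B(2) by simp
    have lower: "\<mu> \<le> \<psi> t" if "t \<le> (B / 2) powr q" for t
      unfolding \<mu>_def \<psi>_def
    proof (intro emeasure_mono powr_level_sets f_meas subsetI CollectI)
      fix x assume "x \<in> {x. B / 2 < \<bar>u x\<bar>}"
      then have "(B / 2) powr q < \<bar>u x\<bar> powr q" "(B / 2) powr q < B powr q"
        using B(2) q by (auto intro!: powr_less_mono2)
      with that show "t < \<bar>min (\<bar>u x\<bar>) B\<bar> powr q"
        using min_powr_less_iff[OF q, of "\<bar>u x\<bar>" B t] B(2) by simp
    qed
    have half_le: "(B / 2) powr q \<le> B powr q"
      using B(2) q by (intro powr_mono2) simp_all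
    have decay: "\<phi> t \<le> ennreal (D * B powr (2 * q) * t powr (- 2)) * \<mu>"
      if "\<mu> < \<infinity>" "B powr q \<le> t" for t
      unfolding \<phi>_def \<mu>_def D_def
      using that half_le by (intro bmo_powr_level_decay[OF u B _ q]) (simp_all only: \<mu>_def)
    show ?thesis
    proof (cases "\<gamma> = \<infinity>")
      case True
      define M where "M = (SUP t\<in>{0<..}. ennreal t * \<psi> t)"
      define c where "c = 1 + D * 2 powr q"
      have c: "1 \<le> c"
        using D by (simp add: c_def)
      have M: "ennreal t * \<psi> t \<le> M" if "0 < t" for t
        unfolding M_def using that by (intro SUP_upper) simp
      have "ennreal ((B / 2) powr q) * \<mu> \<le> ennreal ((B / 2) powr q) * \<psi> ((B / 2) powr q)"
        using lower by (intro mult_left_mono) simp_all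
      also have "\<dots> \<le> M"
        using B(2) by (intro M) simp
      finally have M_lower: "ennreal ((B / 2) powr q) * \<mu> \<le> M" .
      have "ennreal t * \<phi> t \<le> ennreal c * M" if t: "0 < t" for t
      proof (cases "t < B powr q")
        case True
        then have "ennreal t * \<phi> t \<le> 1 * M"
          using M[OF t] eq by simp
        also have "\<dots> \<le> ennreal c * M"
          using c by (intro mult_right_mono) simp_all
        finally show ?thesis .
      next
        case False
        show ?thesis
        proof (cases "\<mu> < \<infinity>")
          case True
          have "ennreal t * \<phi> t \<le> ennreal t * (ennreal (D * B powr (2 * q) * t powr (- 2)) * \<mu>)"
            using decay[OF True] False by (intro mult_left_mono) simp_all
          also have "\<dots> = ennreal (t * (D * B powr (2 * q) * t powr (- 2))) * \<mu>"
            using t D by (simp add: ennreal_mult mult.assoc)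
          also have "\<dots> \<le> ennreal (D * 2 powr q * (B / 2) powr q) * \<mu>"
          proof (intro mult_right_mono ennreal_leI)
            have "t * (D * B powr (2 * q) * t powr (- 2)) = D * B powr q * (B powr q / t)"
              using t B(2) by (simp add: powr_minus power2_eq_square field_simps flip: powr_add)
            also have "\<dots> \<le> D * B powr q * 1"
              using False t D by (intro mult_left_mono) simp_all
            also have "\<dots> = D * 2 powr q * (B / 2) powr q"
              using B(2) by (simp add: powr_divide)
            finally show "t * (D * B powr (2 * q) * t powr (- 2)) \<le> D * 2 powr q * (B / 2) powr q" .
          qed simp
          also have "\<dots> = ennreal (D * 2 powr q) * (ennreal ((B / 2) powr q) * \<mu>)"
            using D by (simp add: ennreal_mult mult.assoc)
          also have "\<dots> \<le> ennreal c * M"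
            using M_lower by (intro mult_mono ennreal_leI) (simp_all add: c_def)
          finally show ?thesis .
        next
          case False
          \<comment> \<open>An infinite \<open>\<mu>\<close> makes the right side infinite, so the
            decay estimate is used only for finite \<open>\<mu>\<close>.\<close>
          then have "M = top"
            using M_lower B(2) by (simp add: not_less top_unique ennreal_mult_top)
          then show ?thesis
            using c by (simp add: ennreal_mult_top)
        qed
      qed
      then have "(SUP t\<in>{0<..}. ennreal t * \<phi> t) \<le> ennreal c * M"
        by (intro SUP_least) simp
      then have "ennpowr (SUP t\<in>{0<..}. ennreal t * \<phi> t) (1 / q) \<le> ennpowr (ennreal c * M) (1 / q)"
        using q by (intro ennpowr_mono) simp_all
      also have "\<dots> = ennreal C * ennpowr M (1 / q)"
        unfolding ennpowr_mult using c True by (subst ennpowr_ennreal) (simp_all add: C_def c_def)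
      finally show ?thesis
        by (simp only: True lorentz_norm_infinity M_def \<phi>_def \<psi>_def)
    next
      case False
      then have g: "0 < g"
        using \<gamma> by (cases \<gamma>) (auto simp: g_def)
      then have a: "0 < a" and qa: "q * a = g"
        using q by (simp_all add: a_def)
      define c where "c = 1 + D powr a * 2 powr g"
      have c: "1 \<le> c"
        by (simp add: c_def)
      define I where "I \<rho> = (\<integral>\<^sup>+t\<in>{0<..}. (ennpowr (\<rho> t) a * ennreal (t powr (a - 1))) \<partial>lborel)"
        for \<rho> :: "real \<Rightarrow> ennreal"
      have I_lower: "ennpowr \<mu> a * ennreal (((B / 2) powr q) powr a / a) \<le> I \<psi>"
      proof -
        have "ennpowr \<mu> a * ennreal (((B / 2) powr q) powr a / a)
          = (\<integral>\<^sup>+t. ennpowr \<mu> a * (ennreal (t powr (a - 1)) * indicator {0..(B / 2) powr q} t) \<partial>lborel)"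
          using a by (simp add: nn_integral_cmult nn_integral_powr_from_0)
        also have "\<dots> \<le> I \<psi>"
          unfolding I_def
        proof (rule nn_integral_mono)
          fix t :: real
          have "ennpowr \<mu> a \<le> ennpowr (\<psi> t) a" if "t \<le> (B / 2) powr q"
            using lower[OF that] a by (intro ennpowr_mono) simp_all
          \<comment> \<open>The convention \<open>0 powr x = 0\<close> reconciles the closed
            interval on the left with the open half-line on the right.\<close>
          moreover have "ennreal (0 powr (a - 1)) = 0"
            by simp
          ultimately show "ennpowr \<mu> a * (ennreal (t powr (a - 1)) * indicator {0..(B / 2) powr q} t)
              \<le> ennpowr (\<psi> t) a * ennreal (t powr (a - 1)) * indicator {0<..} t"
            by (cases "t = 0") (auto simp: indicator_def intro!: mult_right_mono)
        qed
        finally show ?thesis .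
      qed
      have "I \<phi> \<le> ennreal c * I \<psi>"
      proof (cases "\<mu> < \<infinity>")
        case True
        \<comment> \<open>Here \<open>k\<close> is the decay constant and \<open>h\<close> the
          resulting majorant of the integrand from \<open>B powr q\<close> on.\<close>
        define k where "k = D * B powr (2 * q)"
        define h where "h t = ennpowr \<mu> a * ennreal (k powr a) *
          (ennreal (t powr (- a - 1)) * indicator {B powr q..} t)" for t
        have meas [measurable]: "(\<lambda>t. ennpowr (\<psi> t) a) \<in> borel_measurable borel"
        proof (intro borel_measurable_antimono_ennreal antimonoI ennpowr_mono)
          fix s t :: real assume "s \<le> t"
          then show "\<psi> t \<le> \<psi> s"
            unfolding \<psi>_def by (intro emeasure_mono powr_level_sets f_meas) auto
        qed (use a in simp)
        have "I \<phi> \<le> (\<integral>\<^sup>+t. ennpowr (\<psi> t) a * ennreal (t powr (a - 1)) * indicator {0<..} t + h t \<partial>lborel)"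
          unfolding I_def
        proof (rule nn_integral_mono)
          fix t :: real
          show "ennpowr (\<phi> t) a * ennreal (t powr (a - 1)) * indicator {0<..} t
            \<le> ennpowr (\<psi> t) a * ennreal (t powr (a - 1)) * indicator {0<..} t + h t"
          proof (cases "t < B powr q")
            case True
            then show ?thesis
              by (simp add: eq)
          next
            case False
            moreover have "0 < B powr q"
              using B(2) by simp
            ultimately have t: "B powr q \<le> t" "0 < t"
              by linarith+
            have "ennpowr (\<phi> t) a \<le> ennpowr (ennreal (k * t powr (- 2)) * \<mu>) a"
              using decay[OF \<open>\<mu> < \<infinity>\<close> t(1)] a by (intro ennpowr_mono) (simp_all add: k_def)
            also have "\<dots> = ennreal (k powr a * t powr (- 2 * a)) * ennpowr \<mu> a"
              using t(2) D by (simp add: ennpowr_mult ennpowr_ennreal powr_mult powr_powr k_def)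
            finally have "ennpowr (\<phi> t) a * ennreal (t powr (a - 1))
              \<le> ennreal (k powr a * t powr (- 2 * a)) * ennpowr \<mu> a * ennreal (t powr (a - 1))"
              by (intro mult_right_mono) simp_all
            also have "\<dots> = ennpowr \<mu> a * ennreal (k powr a * (t powr (- 2 * a) * t powr (a - 1)))"
              by (simp add: ennreal_mult mult_ac)
            also have "t powr (- 2 * a) * t powr (a - 1) = t powr (- a - 1)"
              by (simp flip: powr_add)
            finally have "ennpowr (\<phi> t) a * ennreal (t powr (a - 1)) \<le> h t"
              using t(1) by (simp add: h_def ennreal_mult mult.assoc)
            then show ?thesis
              using t(2) by (simp add: add_increasing)
          qed
        qed
        also have "\<dots> = I \<psi> + (\<integral>\<^sup>+t. h t \<partial>lborel)"
          unfolding I_def h_def by (rule nn_integral_add; measurable)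
        also have "(\<integral>\<^sup>+t. h t \<partial>lborel)
          = ennpowr \<mu> a * ennreal (k powr a) * ennreal ((B powr q) powr (- a) / a)"
          unfolding h_def using a B(2) by (simp add: nn_integral_cmult nn_integral_powr_to_inf)
        also have "\<dots> = ennpowr \<mu> a * ennreal (k powr a * ((B powr q) powr (- a) / a))"
          using a by (subst ennreal_mult) (simp_all add: mult.assoc)
        \<comment> \<open>The tail integral is proportional to \<open>B powr g\<close>, hence a
          fixed multiple of the weight in \<open>I_lower\<close>.\<close>
        also have "k powr a * ((B powr q) powr (- a) / a)
          = (D powr a * 2 powr g) * (((B / 2) powr q) powr a / a)"
        proof -
          have "k powr a = D powr a * (B powr g * B powr g)"
            using D B(2) by (simp add: k_def powr_mult powr_powr mult.assoc qa flip: powr_add)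
          moreover have "((B / 2) powr q) powr a = B powr g / 2 powr g"
            using B(2) by (simp add: powr_powr qa powr_divide)
          moreover have "(B powr q) powr (- a) = 1 / B powr g"
            using B(2) by (simp add: powr_powr qa powr_minus_divide)
          ultimately show ?thesis
            using B(2) by simp
        qed
        also have "ennpowr \<mu> a * ennreal ((D powr a * 2 powr g) * (((B / 2) powr q) powr a / a))
          = ennreal (D powr a * 2 powr g) * (ennpowr \<mu> a * ennreal (((B / 2) powr q) powr a / a))"
          using a by (subst ennreal_mult) (simp_all only: mult_ac, simp_all)
        also have "I \<psi> + \<dots> \<le> I \<psi> + ennreal (D powr a * 2 powr g) * I \<psi>"
          using I_lower by (intro add_left_mono mult_left_mono) simp_all
        also have "\<dots> = ennreal c * I \<psi>"
          by (simp add: c_def distrib_right)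
        finally show ?thesis .
      next
        case False
        then have "\<mu> = top"
          by (simp add: not_less top_unique)
        then have "I \<psi> = top"
          using I_lower B(2) a by (simp add: ennreal_top_mult top_unique)
        then show ?thesis
          using c by (simp add: ennreal_mult_top)
      qed
      then have "ennpowr (I \<phi>) (1 / g) \<le> ennpowr (ennreal c * I \<psi>) (1 / g)"
        using g by (intro ennpowr_mono) simp_all
      also have "\<dots> = ennreal C * ennpowr (I \<psi>) (1 / g)"
        unfolding ennpowr_mult using c False by (subst ennpowr_ennreal) (simp_all add: C_def c_def)
      finally show ?thesis
        by (simp only: lorentz_norm_finite[OF False] I_def \<phi>_def \<psi>_def g_def a_def)
    qed
  qed
  ultimately show ?thesis
    by blast
qed

section \<open>Second inequality: interpolation below height \<open>B\<close>\<close>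

text \<open>With \<open>s = t powr (p / q)\<close> the level sets of the \<open>q\<close>-th power
  at \<open>t\<close> and of the \<open>p\<close>-th power at \<open>s\<close> coincide, and
  \<open>t < B powr q\<close> puts \<open>s\<close> in the range of the supremum \<open>M\<close>.
  This gives \<open>\<psi> t \<le> t powr (- (p / q)) * M powr q\<close>, where
  \<open>\<psi>\<close> vanishes from \<open>B powr q\<close> on.\<close>

lemma lorentz_truncation_le:
  fixes p q :: real and \<gamma> :: ennreal
  assumes p: "0 < p" "p < q" and \<gamma>: "0 < \<gamma>"
  shows "\<exists>C>0. \<forall>(u :: real ^ 'n \<Rightarrow> real) B. 0 < B \<longrightarrow>
    lorentz_norm q \<gamma> UNIV (\<lambda>x. min \<bar>u x\<bar> B) \<le> ennreal C *
      (SUP s\<in>{s. 0 < s \<and> s \<le> B powr p}.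
        ennpowr (ennreal s * emeasure lebesgue {x. s < \<bar>u x\<bar> powr p}) (1 / q)) *
      ennreal (B powr (1 - p / q))"
proof -
  have q: "0 < q"
    using p by simp
  define g where "g = enn2real \<gamma>"
  define a where "a = g / q"
  \<comment> \<open>The integrand becomes a multiple of \<open>t powr (b - 1)\<close>;
    \<open>p < q\<close> makes \<open>b\<close> positive, so it is integrable at 0.\<close>
  define b where "b = a * (1 - p / q)"
  define C where "C = (if \<gamma> = \<infinity> then 1 else (1 / b) powr (1 / g))"
  have g: "0 < g" if "\<gamma> \<noteq> \<infinity>"
    using \<gamma> that by (cases \<gamma>) (auto simp: g_def)
  have b: "0 < b" if "\<gamma> \<noteq> \<infinity>"
    using g[OF that] p q by (simp add: b_def a_def)
  have "0 < C"
    using b by (auto simp: C_def)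
  moreover have "lorentz_norm q \<gamma> UNIV (\<lambda>x. min \<bar>u x\<bar> B) \<le> ennreal C *
      (SUP s\<in>{s. 0 < s \<and> s \<le> B powr p}.
        ennpowr (ennreal s * emeasure lebesgue {x. s < \<bar>u x\<bar> powr p}) (1 / q)) *
      ennreal (B powr (1 - p / q))"
    if B: "0 < B" for u :: "real ^ 'n \<Rightarrow> real" and B
  proof -
    define M where "M = (SUP s\<in>{s. 0 < s \<and> s \<le> B powr p}.
        ennpowr (ennreal s * emeasure lebesgue {x. s < \<bar>u x\<bar> powr p}) (1 / q))"
    define \<psi> where "\<psi> t = emeasure lebesgue {x. t < \<bar>min (\<bar>u x\<bar>) B\<bar> powr q}" for t
    have zero: "\<psi> t = 0" if "B powr q \<le> t" for t
      unfolding \<psi>_def using that min_powr_less_iff[OF q] B by simp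
    have bound: "\<psi> t \<le> ennreal (t powr (- (p / q))) * ennpowr M q" if t: "0 < t" "t < B powr q" for t
    proof -
      define s where "s = t powr (p / q)"
      have "s \<le> (B powr q) powr (p / q)"
        unfolding s_def using t p q by (intro powr_mono2) simp_all
      then have s: "0 < s" "s \<le> B powr p"
        using t q by (simp_all add: s_def powr_powr)
      have "t < \<bar>u x\<bar> powr q \<longleftrightarrow> s < \<bar>u x\<bar> powr p" for x
        using powr_less_iff_root[of q t "\<bar>u x\<bar>"] powr_less_iff_root[of p s "\<bar>u x\<bar>"] p q t s
        by (simp add: s_def powr_powr)
      then have "\<psi> t = emeasure lebesgue {x. s < \<bar>u x\<bar> powr p}"
        unfolding \<psi>_def using t min_powr_less_iff[OF q] B by simp
      moreover have "ennpowr (ennreal s * emeasure lebesgue {x. s < \<bar>u x\<bar> powr p}) (1 / q) \<le> M"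
        unfolding M_def using s by (intro SUP_upper) simp
      ultimately have "ennpowr (ennpowr (ennreal s * \<psi> t) (1 / q)) q \<le> ennpowr M q"
        using q by (intro ennpowr_mono) simp_all
      then have "ennreal s * \<psi> t \<le> ennpowr M q"
        using q by (simp add: ennpowr_ennpowr)
      then have "ennreal (1 / s) * (ennreal s * \<psi> t) \<le> ennreal (1 / s) * ennpowr M q"
        by (rule mult_left_mono) simp
      moreover have "ennreal (1 / s) * (ennreal s * \<psi> t) = \<psi> t"
        using s by (simp flip: mult.assoc ennreal_mult)
      moreover have "1 / s = t powr (- (p / q))"
        by (simp add: s_def powr_minus_divide)
      ultimately show ?thesis
        by simp
    qed
    show ?thesis
    proof (cases "\<gamma> = \<infinity>")
      case True
      \<comment> \<open>The power \<open>t powr (1 - p / q)\<close> increases, so its endpoint value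
        bounds it and the constant is 1.\<close>
      have "ennreal t * \<psi> t \<le> ennreal ((B powr q) powr (1 - p / q)) * ennpowr M q" if t: "0 < t" for t
      proof (cases "t < B powr q")
        case True
        have "ennreal t * \<psi> t \<le> ennreal t * (ennreal (t powr (- (p / q))) * ennpowr M q)"
          using bound[OF t True] by (intro mult_left_mono) simp_all
        also have "\<dots> = ennreal (t * t powr (- (p / q))) * ennpowr M q"
          using t by (simp add: ennreal_mult mult.assoc)
        also have "t * t powr (- (p / q)) = t powr (1 - p / q)"
          using t by (simp add: powr_diff powr_minus divide_inverse)
        also have "ennreal (t powr (1 - p / q)) * ennpowr M q
            \<le> ennreal ((B powr q) powr (1 - p / q)) * ennpowr M q"
          using t True p q by (intro mult_right_mono ennreal_leI powr_mono2) simp_all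
        finally show ?thesis .
      next
        case False
        then show ?thesis
          using zero by simp
      qed
      then have "(SUP t\<in>{0<..}. ennreal t * \<psi> t) \<le> ennreal ((B powr q) powr (1 - p / q)) * ennpowr M q"
        by (intro SUP_least) simp
      then have "ennpowr (SUP t\<in>{0<..}. ennreal t * \<psi> t) (1 / q)
          \<le> ennpowr (ennreal ((B powr q) powr (1 - p / q)) * ennpowr M q) (1 / q)"
        using q by (intro ennpowr_mono) simp_all
      also have "\<dots> = ennreal (B powr (1 - p / q)) * M"
        using q by (simp add: ennpowr_mult ennpowr_ennreal ennpowr_ennpowr powr_powr)
      finally show ?thesis
        unfolding M_def[symmetric] using True
        by (simp only: True lorentz_norm_infinity C_def \<psi>_def if_True simp_thms ennreal_1 mult_1 mult.commute)
    next
      case False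
      then have g: "0 < g" and b: "0 < b"
        using g b by simp_all
      then have a: "0 < a"
        using q by (simp add: a_def)
      have "(\<integral>\<^sup>+t\<in>{0<..}. (ennpowr (\<psi> t) a * ennreal (t powr (a - 1))) \<partial>lborel)
        \<le> (\<integral>\<^sup>+t. ennpowr M g * (ennreal (t powr (b - 1)) * indicator {0..B powr q} t) \<partial>lborel)"
      proof (rule nn_integral_mono)
        fix t :: real
        show "ennpowr (\<psi> t) a * ennreal (t powr (a - 1)) * indicator {0<..} t
          \<le> ennpowr M g * (ennreal (t powr (b - 1)) * indicator {0..B powr q} t)"
        proof (cases "0 < t \<and> t < B powr q")
          case True
          then have "ennpowr (\<psi> t) a \<le> ennpowr (ennreal (t powr (- (p / q))) * ennpowr M q) a"
            using bound a by (intro ennpowr_mono) simp_all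
          also have "\<dots> = ennreal (t powr (- (p / q) * a)) * ennpowr M g"
            using q by (simp add: ennpowr_mult ennpowr_ennreal ennpowr_ennpowr powr_powr a_def)
          finally have "ennpowr (\<psi> t) a * ennreal (t powr (a - 1))
            \<le> ennreal (t powr (- (p / q) * a)) * ennpowr M g * ennreal (t powr (a - 1))"
            by (intro mult_right_mono) simp_all
          also have "\<dots> = ennpowr M g * ennreal (t powr (- (p / q) * a) * t powr (a - 1))"
            by (simp add: ennreal_mult mult_ac)
          also have "t powr (- (p / q) * a) * t powr (a - 1) = t powr (b - 1)"
            by (simp add: b_def algebra_simps flip: powr_add)
          finally show ?thesis
            using True by simp
        next
          case False
          then have "t \<le> 0 \<or> B powr q \<le> t"
            by auto
          then show ?thesis
            using zero by auto
        qed
      qed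
      also have "\<dots> = ennpowr M g * ennreal ((B powr q) powr b / b)"
        using b by (simp add: nn_integral_cmult nn_integral_powr_from_0)
      finally have "ennpowr (\<integral>\<^sup>+t\<in>{0<..}. (ennpowr (\<psi> t) a * ennreal (t powr (a - 1))) \<partial>lborel) (1 / g)
          \<le> ennpowr (ennpowr M g * ennreal ((B powr q) powr b / b)) (1 / g)"
        using g by (intro ennpowr_mono) simp_all
      also have "\<dots> = M * ennreal (((B powr q) powr b / b) powr (1 / g))"
        using g b by (simp add: ennpowr_mult ennpowr_ennreal ennpowr_ennpowr)
      also have "((B powr q) powr b / b) powr (1 / g) = C * B powr (1 - p / q)"
      proof -
        have "q * b * (1 / g) = 1 - p / q"
          using q g by (simp add: b_def a_def)
        then have "((B powr q) powr b) powr (1 / g) = B powr (1 - p / q)"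
          by (simp only: powr_powr)
        then show ?thesis
          using False b by (simp add: C_def powr_divide)
      qed
      also have "M * ennreal (C * B powr (1 - p / q)) = ennreal C * M * ennreal (B powr (1 - p / q))"
        using \<open>0 < C\<close> by (simp add: ennreal_mult mult_ac)
      finally show ?thesis
        unfolding M_def[symmetric] by (simp only: lorentz_norm_finite[OF False] \<psi>_def g_def a_def)
    qed
  qed
  ultimately show ?thesis
    by blast
qed

text \<open>All level sets at positive heights lie in one null set. This covers the two degenerate
  cases with BMO norm zero: \<open>u\<close> vanishing almost everywhere, and truncation at height
  0.\<close>

lemma lorentz_norm_AE_0:
  fixes f :: "real ^ 'n \<Rightarrow> real"
  assumes f: "AE x in lebesgue. f x = 0" and q: "0 < q"
  shows "lorentz_norm q \<gamma> UNIV f = 0"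
proof -
  have "emeasure lebesgue {x. t < \<bar>f x\<bar> powr q} = 0" if "0 < t" for t
  proof -
    obtain N where N: "N \<in> null_sets lebesgue" "{x \<in> space lebesgue. f x \<noteq> 0} \<subseteq> N"
      using f by (auto simp: eventually_ae_filter)
    have "{x. t < \<bar>f x\<bar> powr q} \<subseteq> N"
      using N(2) that by (force simp: subset_iff)
    then show ?thesis
      using N(1) by (meson emeasure_eq_0 null_setsD1 null_setsD2)
  qed
  note zero = this
  show ?thesis
  proof (cases "\<gamma> = \<infinity>")
    case True
    have "(SUP t\<in>{0<..}. ennreal t * emeasure lebesgue {x. t < \<bar>f x\<bar> powr q}) \<le> 0"
      by (rule SUP_least) (simp only: greaterThan_iff zero mult_zero_right order_refl)
    then show ?thesis
      by (simp only: True lorentz_norm_infinity le_zero_eq ennpowr_0)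
  next
    case False
    have "(\<lambda>t. ennpowr (emeasure lebesgue {x. t < \<bar>f x\<bar> powr q}) (enn2real \<gamma> / q) *
        ennreal (t powr (enn2real \<gamma> / q - 1)) * indicator {0<..} t) = (\<lambda>t. 0)"
    proof
      fix t
      show "ennpowr (emeasure lebesgue {x. t < \<bar>f x\<bar> powr q}) (enn2real \<gamma> / q) *
          ennreal (t powr (enn2real \<gamma> / q - 1)) * indicator {0<..} t = 0"
        using zero[of t] by (cases "0 < t") (simp_all only: ennpowr_0, simp_all)
    qed
    then show ?thesis
      by (simp add: lorentz_norm_finite[OF False])
  qed
qed

section \<open>Assembling the chain of inequalities\<close>

theorem theorem1p7:
  fixes p q :: real and \<gamma> :: ennreal
  assumes "0 < p" and "p < q" and "0 < \<gamma>"
  shows "\<exists>C1 C2 C3 :: real. 0 < C1 \<and> 0 < C2 \<and> 0 < C3 \<and>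
    (\<forall>u :: real ^ 'n \<Rightarrow> real.
      u \<in> BMO \<longrightarrow> \<not> (\<exists>c. c \<noteq> 0 \<and> (AE x in lebesgue. u x = c)) \<longrightarrow>
        lorentz_norm q \<gamma> UNIV u
          \<le> ennreal C1 * lorentz_norm q \<gamma> UNIV (\<lambda>x. min \<bar>u x\<bar> (enn2real (bmo_norm u))) \<and>
        ennreal C1 * lorentz_norm q \<gamma> UNIV (\<lambda>x. min \<bar>u x\<bar> (enn2real (bmo_norm u)))
          \<le> ennreal C2 *
            (SUP s\<in>{s :: real. 0 < s \<and> ennreal s \<le> ennpowr (bmo_norm u) p}.
               ennpowr (ennreal s * emeasure lebesgue {x. \<bar>u x\<bar> powr p > s}) (1 / q)) *
            ennpowr (bmo_norm u) (1 - p / q) \<and>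
        ennreal C2 *
            (SUP s\<in>{s :: real. 0 < s \<and> ennreal s \<le> ennpowr (bmo_norm u) p}.
               ennpowr (ennreal s * emeasure lebesgue {x. \<bar>u x\<bar> powr p > s}) (1 / q)) *
            ennpowr (bmo_norm u) (1 - p / q)
          \<le> ennreal C3 * ennpowr (weak_Lp_norm p UNIV u) (p / q) * ennpowr (bmo_norm u) (1 - p / q))"
proof -
  have q: "0 < q"
    using assms by simp
  obtain C1 where C1: "0 < C1" and truncation: "\<And>(u :: real ^ 'n \<Rightarrow> real) B.
      u \<in> borel_measurable lebesgue \<Longrightarrow> bmo_norm u = ennreal B \<Longrightarrow> 0 < B \<Longrightarrow>
      lorentz_norm q \<gamma> UNIV u \<le> ennreal C1 * lorentz_norm q \<gamma> UNIV (\<lambda>x. min \<bar>u x\<bar> B)"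
    using lorentz_le_truncation[OF q assms(3), where 'n = 'n] by blast
  obtain C where C: "0 < C" and interpolation: "\<And>(u :: real ^ 'n \<Rightarrow> real) B. 0 < B \<Longrightarrow>
      lorentz_norm q \<gamma> UNIV (\<lambda>x. min \<bar>u x\<bar> B) \<le> ennreal C *
        (SUP s\<in>{s. 0 < s \<and> s \<le> B powr p}.
          ennpowr (ennreal s * emeasure lebesgue {x. s < \<bar>u x\<bar> powr p}) (1 / q)) *
        ennreal (B powr (1 - p / q))"
    using lorentz_truncation_le[OF assms, where 'n = 'n] by blast
  \<comment> \<open>The second inequality starts from \<open>C1\<close> times the truncated norm.
    The third only enlarges the range of a supremum, so \<open>C2\<close> serves there as
    \<open>C3\<close> too.\<close>
  define C2 where "C2 = C1 * C"
  have C2: "0 < C2"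
    using C1 C by (simp add: C2_def)
  show ?thesis
  proof (rule exI[of _ C1], rule exI[of _ C2], rule exI[of _ C2], intro conjI C1 C2 allI impI)
    fix u :: "real ^ 'n \<Rightarrow> real"
    assume u: "u \<in> BMO" and nonconst: "\<not> (\<exists>c. c \<noteq> 0 \<and> (AE x in lebesgue. u x = c))"
    have meas: "u \<in> borel_measurable lebesgue"
      using u by (rule BMO_measurable)
    obtain B where B: "bmo_norm u = ennreal B" "0 \<le> B"
      using u by (cases "bmo_norm u") (auto simp: BMO_def)
    let ?f = "\<lambda>x. min \<bar>u x\<bar> (enn2real (bmo_norm u))"
    let ?M = "SUP s\<in>{s :: real. 0 < s \<and> ennreal s \<le> ennpowr (bmo_norm u) p}.
               ennpowr (ennreal s * emeasure lebesgue {x. s < \<bar>u x\<bar> powr p}) (1 / q)"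
    have f_eq: "?f = (\<lambda>x. min \<bar>u x\<bar> B)"
      using B by simp
    have M_eq: "?M = (SUP s\<in>{s. 0 < s \<and> s \<le> B powr p}.
          ennpowr (ennreal s * emeasure lebesgue {x. s < \<bar>u x\<bar> powr p}) (1 / q))"
      using B by (simp add: ennpowr_ennreal)
    have pow_eq: "ennpowr (bmo_norm u) (1 - p / q) = ennreal (B powr (1 - p / q))"
      using B by (simp add: ennpowr_ennreal)
    show "lorentz_norm q \<gamma> UNIV u \<le> ennreal C1 * lorentz_norm q \<gamma> UNIV ?f"
    proof (cases "B = 0")
      case True
      then obtain c where c: "AE x in lebesgue. u x = c"
        using bmo_norm_0_imp_AE_const[OF meas] B by auto
      \<comment> \<open>Excluding nonzero constants leaves only \<open>u = 0\<close> almost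
        everywhere when the BMO norm vanishes.\<close>
      have "c = 0"
      proof (rule ccontr)
        assume "c \<noteq> 0"
        then have "\<exists>c. c \<noteq> 0 \<and> (AE x in lebesgue. u x = c)"
          using c by (intro exI[of _ c] conjI)
        with nonconst show False
          by (rule notE)
      qed
      with c have "lorentz_norm q \<gamma> UNIV u = 0"
        by (intro lorentz_norm_AE_0[OF _ q]) simp
      then show ?thesis
        by simp
    next
      case False
      then show ?thesis
        unfolding f_eq using B by (intro truncation meas) simp_all
    qed
    show "ennreal C1 * lorentz_norm q \<gamma> UNIV ?f \<le> ennreal C2 * ?M * ennpowr (bmo_norm u) (1 - p / q)"
    proof (cases "B = 0")
      case True
      then have "lorentz_norm q \<gamma> UNIV ?f = 0"
        unfolding f_eq by (intro lorentz_norm_AE_0[OF _ q]) simp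
      then show ?thesis
        by simp
    next
      case False
      then have "ennreal C1 * lorentz_norm q \<gamma> UNIV ?f \<le> ennreal C1 * (ennreal C * ?M * ennreal (B powr (1 - p / q)))"
        unfolding f_eq M_eq using B by (intro mult_left_mono interpolation) simp_all
      also have "\<dots> = ennreal C2 * ?M * ennpowr (bmo_norm u) (1 - p / q)"
        unfolding pow_eq C2_def using C1 C by (simp only: ennreal_mult less_imp_le mult.assoc)
      finally show ?thesis .
    qed
    \<comment> \<open>The weak norm takes the supremum over all positive heights; its root
      \<open>1 / p\<close> and the power \<open>p / q\<close> combine to
      \<open>1 / q\<close>.\<close>
    have "?M \<le> ennpowr (weak_Lp_norm p UNIV u) (p / q)"
    proof (rule SUP_least)
      fix s assume "s \<in> {s. 0 < s \<and> ennreal s \<le> ennpowr (bmo_norm u) p}"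
      then have "ennreal s * emeasure lebesgue {x. s < \<bar>u x\<bar> powr p}
          \<le> (SUP t\<in>{0<..}. ennreal t * emeasure lebesgue {x. t < \<bar>u x\<bar> powr p})"
        by (intro SUP_upper) simp
      then have "ennpowr (ennreal s * emeasure lebesgue {x. s < \<bar>u x\<bar> powr p}) (1 / q)
          \<le> ennpowr (SUP t\<in>{0<..}. ennreal t * emeasure lebesgue {x. t < \<bar>u x\<bar> powr p}) (1 / q)"
        using q by (intro ennpowr_mono) simp_all
      also have "\<dots> = ennpowr (weak_Lp_norm p UNIV u) (p / q)"
        using assms(1) by (simp add: weak_Lp_norm_def lorentz_norm_infinity ennpowr_ennpowr
            flip: infinity_ennreal_def)
      finally show "ennpowr (ennreal s * emeasure lebesgue {x. s < \<bar>u x\<bar> powr p}) (1 / q)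
          \<le> ennpowr (weak_Lp_norm p UNIV u) (p / q)" .
    qed
    then show "ennreal C2 * ?M * ennpowr (bmo_norm u) (1 - p / q)
        \<le> ennreal C2 * ennpowr (weak_Lp_norm p UNIV u) (p / q) * ennpowr (bmo_norm u) (1 - p / q)"
      by (intro mult_right_mono mult_left_mono) simp_all
  qed
qed

end
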